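(* Let $A(z)$ be an entire function with $\lambda(A)<\rho(A)=n$ for some positive integer $n$, and let $B(z)$ be an entire function having Fejér gaps. Then every non-trivial solution $f$ of the differential equation $f''+A(z)f'+B(z)f=0$ is of infinite order, i.e. $\rho(f)=\infty$.
   Context: All solutions of the equation with entire coefficients are entire functions; a solution is non-trivial if it is not identically zero. For an entire function $f$: $T(r,f)=\frac{1}{2\pi}\int_0^{2\pi}\log^+|f(re^{i\theta})|\,d\theta$ is the Nevanlinna characteristic; the order of growth is $\rho(f)=\limsup_{r\to\infty}\frac{\log^+ T(r,f)}{\log r}$; and $\lambda(f)$ is the exponent of convergence of the zeros of $f$, i.e. $\lambda(f)=\inf\{s>0:\sum_k |z_k|^{-s}<\infty\}$, where $z_k$ are the nonzero zeros of $f$ counted with multiplicity. An entire function $f(z)=\sum_{n=0}^{\infty}a_{\lambda_n}z^{\lambda_n}$, where $(\lambda_n)$ is a strictly increasing infinite sequence of non-negative integers and all $a_{\lambda_n}\neq 0$, has Fejér gaps if the series $\sum_{n}\frac{1}{\lambda_n}$ converges (a term with $\lambda_n=0$ being omitted). *)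

theory Defs
  imports "HOL-Complex_Analysis.Complex_Analysis" "HOL-Library.Extended_Real"
    "HOL-Library.Liminf_Limsup"
begin

(* log^+ 0 = 0, as usual, because ln 0 = 0. *)
definition log_plus :: "real \<Rightarrow> real" where
  "log_plus x = max 0 (ln x)"

definition nevanlinna_T :: "(complex \<Rightarrow> complex) \<Rightarrow> real \<Rightarrow> real" where
  "nevanlinna_T f r =
     1 / (2 * pi) * integral {0..2 * pi} (\<lambda>\<theta>. log_plus (cmod (f (of_real r * exp (\<i> * of_real \<theta>)))))"

definition growth_order :: "(complex \<Rightarrow> complex) \<Rightarrow> ereal" where
  "growth_order f = Limsup at_top (\<lambda>r::real. ereal (log_plus (nevanlinna_T f r) / ln r))"

(* The sum over the zeros with multiplicity is written as a sum over the distinct nonzero zeros,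
   each weighted by its multiplicity. The value is infinity if no exponent s works. Only meaningful
   for an entire f that is not identically zero. *)
definition zero_exponent :: "(complex \<Rightarrow> complex) \<Rightarrow> ereal" where
  "zero_exponent f =
     Inf (ereal ` {s. s > 0 \<and>
       (\<lambda>z. real_of_int (zorder f z) * cmod z powr (- s)) summable_on {z. z \<noteq> 0 \<and> f z = 0}})"

(* A term with l n = 0 contributes nothing to the last series, because 1 / 0 = 0. *)
definition fejer_gaps :: "(complex \<Rightarrow> complex) \<Rightarrow> bool" where
  "fejer_gaps f \<longleftrightarrow>
     (\<exists>(l :: nat \<Rightarrow> nat) (a :: nat \<Rightarrow> complex).
        strict_mono l \<and> (\<forall>k. a k \<noteq> 0) \<and>
        (\<forall>z. (\<lambda>k. a k * z ^ l k) sums f z) \<and>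
        summable (\<lambda>k. 1 / real (l k)))"

end

theory Submission
  imports Defs
begin

text \<open>
  Suppose that a non-trivial solution \<open>f\<close> has finite order. Dividing the equation by \<open>f\<close> gives
  \<open>B = - f''/f - A f'/f\<close>, and the two terms on the right can be controlled separately.

  \<^item> The quotients \<open>f'/f\<close> and \<open>f''/f\<close> are at most a power of \<open>r\<close> on every circle \<open>|z| = r\<close> that keeps
    away from the zeros of \<open>f\<close>. There are only polynomially many zeros in a disc, so each interval
    \<open>[x, x + 1]\<close> contains such a radius (\<open>log_derivatives_polynomial_on_circles\<close>).
  \<^item> The zeros of \<open>A\<close> are too sparse to influence its growth: there are \<open>a \<noteq> 0\<close> and \<open>s < n\<close> with
    \<open>|A z| \<le> exp (C |z|^s + Re (a z^n))\<close> for \<open>|z| \<ge> 1\<close> (\<open>exponential_type_structure\<close>). In a sector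
    where \<open>Re (a z^n)\<close> is negative this gives \<open>|A| \<le> 1\<close> far out (\<open>small_sector\<close>).

  So \<open>B\<close> has polynomial size on arcs of a fixed angular width, at radii on every scale, and it has
  finite order. A power series with Fejer gaps cannot do that
  (\<open>gap_series_not_polynomial_on_arcs\<close>). Put \<open>G r = (\<Sum>k. |a k| r^(l k))\<close>. Finite order provides
  arbitrarily large \<open>r\<close> with \<open>ln (G (2 r)) \<le> C ln (G r)\<close>; there the terms of degree above
  \<open>T = 2 C ln (G r)\<close> are negligible. Convergence of \<open>\<Sum>k. 1 / l k\<close> leaves only \<open>o(T)\<close> terms of
  degree at most \<open>T\<close>, and a trigonometric polynomial with \<open>o(T)\<close> frequencies in \<open>[0, T]\<close> has
  coefficients at most \<open>exp (o(T))\<close> times its maximum on an arc of fixed length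
  (\<open>trig_polynomial_coefficient_bound\<close>, a local estimate in the style of Turan). Hence \<open>G r\<close> is at
  most \<open>sqrt (G r)\<close> times a power of \<open>r\<close>, for arbitrarily large \<open>r\<close>, and only finitely many
  coefficients can be nonzero.

  Both facts about entire functions come from one principle. Once the zeros in a disc are divided
  out, what remains is \<open>exp h\<close>, and the Taylor coefficients of \<open>h\<close> are bounded by the mean of the
  positive part of \<open>Re h\<close> on a circle (\<open>taylor_coefficient_le_circle_mean\<close>), which is in essence a
  Nevanlinna characteristic. For \<open>f\<close> the zeros are removed by Blaschke factors, which do not change
  the modulus on the circle; for \<open>A\<close> by Weierstrass factors, whose product grows no faster than
  \<open>exp (C |z|^s)\<close>, uniformly in the radius of the disc.
\<close>

section \<open>Means over circles and Taylor coefficients\<close>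

text \<open>
  The parametrization of the circle by \<open>[0, 1]\<close> is the one of \<open>circlepath\<close>, which makes Cauchy's
  integral formula directly applicable.
\<close>

definition circle_mean :: "(complex \<Rightarrow> real) \<Rightarrow> real \<Rightarrow> real" where
  "circle_mean u r = integral {0..1} (\<lambda>t. u (circlepath 0 r t))"

lemma circlepath_0_eq: "circlepath 0 r t = of_real r * exp (2 * of_real pi * \<i> * of_real t)"
  by (simp add: circlepath)

lemma norm_circlepath_0: "norm (circlepath 0 r t) = \<bar>r\<bar>"
proof -
  have "norm (exp (2 * of_real pi * \<i> * of_real t)) = 1" by simp
  then show ?thesis unfolding circlepath_0_eq norm_mult by simp
qed

lemma circle_integrable:
  fixes u :: "complex \<Rightarrow> 'a::euclidean_space"
  assumes "continuous_on (sphere 0 r) u" "r > 0"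
  shows "(\<lambda>t. u (circlepath 0 r t)) integrable_on {0..1}"
proof (rule integrable_continuous_real)
  have "continuous_on {0..1} (circlepath 0 r)" using path_circlepath unfolding path_def .
  then show "continuous_on {0..1} (\<lambda>t. u (circlepath 0 r t))"
    by (rule continuous_on_compose2[OF assms(1)]) (use assms(2) in \<open>auto simp: norm_circlepath_0\<close>)
qed

lemma circle_mean_mono:
  assumes "continuous_on (sphere 0 r) u" "continuous_on (sphere 0 r) v" "r > 0"
    and "\<And>z. norm z = r \<Longrightarrow> u z \<le> v z"
  shows "circle_mean u r \<le> circle_mean v r"
  unfolding circle_mean_def
  by (rule integral_le) (use assms in \<open>auto intro: circle_integrable simp: norm_circlepath_0\<close>)

lemma circle_mean_cong:
  assumes "r > 0" "\<And>z. norm z = r \<Longrightarrow> u z = v z"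
  shows "circle_mean u r = circle_mean v r"
  unfolding circle_mean_def by (rule integral_cong) (use assms in \<open>auto simp: norm_circlepath_0\<close>)

lemma circle_mean_const [simp]: "circle_mean (\<lambda>_. c) r = c"
  by (simp add: circle_mean_def)

lemma circle_mean_add:
  assumes "continuous_on (sphere 0 r) u" "continuous_on (sphere 0 r) v" "r > 0"
  shows "circle_mean (\<lambda>z. u z + v z) r = circle_mean u r + circle_mean v r"
  unfolding circle_mean_def
  by (rule integral_add) (use assms in \<open>auto intro: circle_integrable\<close>)

lemma circle_mean_diff:
  assumes "continuous_on (sphere 0 r) u" "continuous_on (sphere 0 r) v" "r > 0"
  shows "circle_mean (\<lambda>z. u z - v z) r = circle_mean u r - circle_mean v r"
  unfolding circle_mean_def
  by (rule integral_diff) (use assms in \<open>auto intro: circle_integrable\<close>)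

lemma circle_mean_cmult: "circle_mean (\<lambda>z. c * u z) r = c * circle_mean u r"
  unfolding circle_mean_def by simp

text \<open>
  In this form continuity of \<open>log_plus\<close> on \<open>[0, \<infinity>)\<close>, in particular at 0, is evident.
\<close>

lemma log_plus_eq_ln_max: "x \<ge> 0 \<Longrightarrow> log_plus x = ln (max 1 x)"
  unfolding log_plus_def by (cases "x = 0") (auto simp: max_def)

lemma log_plus_nonneg [simp]: "log_plus x \<ge> 0"
  by (simp add: log_plus_def)

lemma ln_le_log_plus: "ln x \<le> log_plus x"
  by (simp add: log_plus_def)

lemma log_plus_mono: "0 \<le> x \<Longrightarrow> x \<le> y \<Longrightarrow> log_plus x \<le> log_plus y"
  by (simp add: log_plus_eq_ln_max)

lemma log_plus_le_iff: "0 \<le> x \<Longrightarrow> 0 \<le> c \<Longrightarrow> log_plus x \<le> c \<longleftrightarrow> x \<le> exp c"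
  using ln_le_cancel_iff[of "max 1 x" "exp c"] by (simp add: log_plus_eq_ln_max)

lemma continuous_on_log_plus_norm:
  fixes F :: "complex \<Rightarrow> complex"
  assumes "continuous_on S F"
  shows "continuous_on S (\<lambda>z. log_plus (norm (F z)))"
proof -
  have "continuous_on S (\<lambda>z. ln (max 1 (norm (F z))))"
    by (intro continuous_intros assms) auto
  then show ?thesis by (simp add: log_plus_eq_ln_max)
qed

lemma nevanlinna_T_eq_circle_mean:
  assumes "continuous_on (sphere 0 r) F" "r > 0"
  shows "nevanlinna_T F r = circle_mean (\<lambda>z. log_plus (norm (F z))) r"
proof -
  define g where "g \<theta> = log_plus (cmod (F (of_real r * exp (\<i> * of_real \<theta>))))" for \<theta>
  have "continuous_on UNIV (\<lambda>\<theta>. F (of_real r * exp (\<i> * of_real \<theta>)))"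
    by (rule continuous_on_compose2[OF assms(1)])
       (use assms(2) in \<open>auto intro!: continuous_intros simp: norm_mult\<close>)
  then have "continuous_on {0..2*pi} (\<lambda>\<theta>. ln (max 1 (norm (F (of_real r * exp (\<i> * of_real \<theta>))))))"
    by (intro continuous_intros) (auto elim: continuous_on_subset)
  then have "continuous_on {0..2*pi} g"
    by (simp add: g_def log_plus_eq_ln_max)
  then have "(g has_integral integral {0..2*pi} g) {0..2*pi}"
    by (intro integrable_integral integrable_continuous_real)
  from has_integral_stretch_real[OF this, of "2 * pi"]
  have *: "((\<lambda>t. g (2 * pi * t)) has_integral 1 / (2 * pi) * integral {0..2 * pi} g) ((\<lambda>x. x / (2 * pi)) ` {0..2*pi})"
    by simp
  have "(\<lambda>x. x / (2 * pi)) ` {0..2*pi} = {0..1}"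
  proof safe
    fix x :: real assume "x \<in> {0..1}"
    then show "x \<in> (\<lambda>x. x / (2 * pi)) ` {0..2 * pi}"
      by (intro image_eqI[of _ _ "2 * pi * x"]) (auto simp: mult_le_cancel_left1)
  qed (auto simp: field_simps)
  with * have "integral {0..1} (\<lambda>t. g (2 * pi * t)) = 1 / (2 * pi) * integral {0..2 * pi} g"
    by (auto simp: integral_unique)
  moreover have "g (2 * pi * t) = log_plus (norm (F (circlepath 0 r t)))" for t
    by (simp add: g_def circlepath_0_eq mult_ac)
  ultimately show ?thesis
    by (simp add: nevanlinna_T_def circle_mean_def g_def [abs_def])
qed

lemma circle_integral_taylor_coefficient:
  assumes "h holomorphic_on ball 0 R" "0 < r" "r < R"
  shows "((\<lambda>t. h (circlepath 0 r t) / circlepath 0 r t ^ j)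
           has_integral (deriv ^^ j) h 0 / fact j) {0..1}"
proof -
  have "((\<lambda>u. h u / (u - 0) ^ Suc j) has_contour_integral
          (2 * pi * \<i>) / fact j * (deriv ^^ j) h 0) (circlepath 0 r)"
  proof (rule Cauchy_has_contour_integral_higher_derivative_circlepath)
    show "continuous_on (cball 0 r) h"
      by (rule continuous_on_subset[OF holomorphic_on_imp_continuous_on[OF assms(1)]]) (use assms in auto)
    show "h holomorphic_on ball 0 r"
      by (rule holomorphic_on_subset[OF assms(1)]) (use assms in auto)
  qed (use assms in auto)
  then have "((\<lambda>t. h (circlepath 0 r t) / circlepath 0 r t ^ Suc j *
       (2 * pi * \<i> * of_real r * exp (2 * of_real pi * \<i> * of_real t))) has_integral
          (2 * pi * \<i>) / fact j * (deriv ^^ j) h 0) {0..1}"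
    unfolding has_contour_integral_def
    by (rule has_integral_eq[rotated]) (simp add: vector_derivative_circlepath01 mult_ac)
  then have "((\<lambda>t. h (circlepath 0 r t) / circlepath 0 r t ^ Suc j *
       (2 * pi * \<i> * circlepath 0 r t)) has_integral
          (2 * pi * \<i>) / fact j * (deriv ^^ j) h 0) {0..1}"
    by (simp add: circlepath_0_eq mult_ac)
  from has_integral_mult_right[OF this, of "1 / (2 * pi * \<i>)"]
  have *: "((\<lambda>t. 1 / (2 * pi * \<i>) * (h (circlepath 0 r t) / circlepath 0 r t ^ Suc j *
       (2 * pi * \<i> * circlepath 0 r t))) has_integral (deriv ^^ j) h 0 / fact j) {0..1}"
    by simp
  have "1 / (2 * pi * \<i>) * (h (circlepath 0 r t) / circlepath 0 r t ^ Suc j *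
       (2 * pi * \<i> * circlepath 0 r t)) = h (circlepath 0 r t) / circlepath 0 r t ^ j" for t
  proof -
    have "norm (circlepath 0 r t) \<noteq> 0" using assms(2) by (simp add: norm_circlepath_0)
    then show ?thesis by (simp add: field_simps)
  qed
  with * show ?thesis by simp
qed

lemma circle_mean_Re:
  assumes "h holomorphic_on ball 0 R" "0 < r" "r < R"
  shows "circle_mean (\<lambda>z. Re (h z)) r = Re (h 0)"
  using has_integral_Re[OF circle_integral_taylor_coefficient[OF assms, of 0]]
  by (simp add: circle_mean_def integral_unique)

text \<open>
  Since \<open>z^j h\<close> has mean 0 on the circle, adding the conjugate of \<open>h\<close> does not change the \<open>j\<close>-th
  Fourier coefficient; the coefficient of \<open>h\<close> is therefore that of \<open>2 Re h\<close>. Finally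
  \<open>|Re h| = 2 max 0 (Re h) - Re h\<close>, and the mean of \<open>Re h\<close> is \<open>Re (h 0)\<close>. The point is that an upper
  bound for \<open>Re h\<close> alone controls \<open>h\<close>.
\<close>

lemma taylor_coefficient_le_circle_mean:
  assumes h: "h holomorphic_on ball 0 R" and r: "0 < r" "r < R" and j: "j > 0"
  shows "norm ((deriv ^^ j) h 0 / fact j) * r ^ j \<le>
           4 * circle_mean (\<lambda>z. max 0 (Re (h z))) r - 2 * Re (h 0)"
proof -
  define a where "a = (deriv ^^ j) h 0 / fact j"
  define c where "c = circlepath 0 r"
  have nc: "norm (c t) = r" for t using r by (simp add: c_def norm_circlepath_0)
  have 1: "((\<lambda>t. h (c t) / c t ^ j) has_integral a) {0..1}"
    unfolding a_def c_def by (rule circle_integral_taylor_coefficient[OF h r])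
  have "(\<lambda>z. z ^ j * h z) holomorphic_on ball 0 R"
    by (intro holomorphic_intros h)
  from circle_integral_taylor_coefficient[OF this r, of 0]
  have "((\<lambda>t. c t ^ j * h (c t)) has_integral 0) {0..1}"
    using j by (simp add: c_def zero_power)
  then have "((\<lambda>t. cnj (c t ^ j * h (c t))) has_integral 0) {0..1}"
    using has_integral_cnj[of "\<lambda>t. c t ^ j * h (c t)" 0 "{0..1}"] by (simp add: o_def)
  \<comment> \<open>On the circle the conjugate of \<open>c t\<close> is \<open>r\<^sup>2 / c t\<close>.\<close>
  then have "((\<lambda>t. (1 / of_real r ^ (2 * j)) * cnj (c t ^ j * h (c t))) has_integral 0) {0..1}"
    by (rule has_integral_mult_right[where y = 0, simplified])
  also have "(\<lambda>t. (1 / of_real r ^ (2 * j)) * cnj (c t ^ j * h (c t))) = (\<lambda>t. cnj (h (c t)) / c t ^ j)"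
  proof
    fix t
    have "c t \<noteq> 0" using nc[of t] r by auto
    moreover have "c t * cnj (c t) = of_real (r\<^sup>2)"
      by (simp add: complex_norm_square [symmetric] nc)
    then have "c t ^ j * cnj (c t) ^ j = of_real r ^ (2 * j)"
      by (simp add: power_mult_distrib [symmetric] power_mult)
    ultimately show "(1 / of_real r ^ (2 * j)) * cnj (c t ^ j * h (c t)) = cnj (h (c t)) / c t ^ j"
      using r by (simp add: field_simps)
  qed
  finally have "((\<lambda>t. h (c t) / c t ^ j + cnj (h (c t)) / c t ^ j) has_integral a + 0) {0..1}"
    by (rule has_integral_add[OF 1])
  moreover have "h (c t) / c t ^ j + cnj (h (c t)) / c t ^ j = 2 * of_real (Re (h (c t))) / c t ^ j" for t
    by (simp add: add_divide_distrib [symmetric] complex_add_cnj)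
  ultimately have 2: "((\<lambda>t. 2 * of_real (Re (h (c t))) / c t ^ j) has_integral a) {0..1}"
    by simp
  have contRe: "continuous_on (sphere 0 r) (\<lambda>z. Re (h z))"
    by (intro continuous_intros continuous_on_subset[OF holomorphic_on_imp_continuous_on[OF h]]) (use r in auto)
  have "norm (integral {0..1} (\<lambda>t. 2 * of_real (Re (h (c t))) / c t ^ j)) \<le>
        integral {0..1} (\<lambda>t. (2 / r ^ j) * \<bar>Re (h (c t))\<bar>)"
  proof (rule integral_norm_bound_integral)
    show "(\<lambda>t. 2 * complex_of_real (Re (h (c t))) / c t ^ j) integrable_on {0..1}" using 2 by blast
    show "(\<lambda>t. (2 / r ^ j) * \<bar>Re (h (c t))\<bar>) integrable_on {0..1}"
      unfolding c_def by (intro circle_integrable continuous_intros contRe r)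
  qed (simp add: norm_divide norm_mult norm_power nc)
  also have "\<dots> = (2 / r ^ j) * circle_mean (\<lambda>z. \<bar>Re (h z)\<bar>) r"
    by (simp add: circle_mean_def c_def)
  also have "circle_mean (\<lambda>z. \<bar>Re (h z)\<bar>) r = circle_mean (\<lambda>z. 2 * max 0 (Re (h z)) - Re (h z)) r"
    by (rule circle_mean_cong) (use r in auto)
  also have "\<dots> = 2 * circle_mean (\<lambda>z. max 0 (Re (h z))) r - Re (h 0)"
    using circle_mean_Re[OF h r]
    by (subst circle_mean_diff) (use r in \<open>auto simp: circle_mean_cmult intro!: continuous_intros contRe\<close>)
  finally show ?thesis
    using r 2 by (simp add: integral_unique a_def field_simps)
qed

text \<open>
  The coefficient bound makes the tail of the Taylor series a geometric series of ratio at most 1/2.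
\<close>

lemma taylor_tail_bound:
  assumes h: "h holomorphic_on ball 0 R" and r: "0 < \<rho>" "\<rho> < R" and u: "2 * norm u \<le> \<rho>"
    and D: "\<And>j. j > 0 \<Longrightarrow> norm ((deriv ^^ j) h 0 / fact j) * \<rho> ^ j \<le> D"
  shows "norm (h u - (\<Sum>j\<le>n. (deriv ^^ j) h 0 / fact j * u ^ j)) \<le> 2 * D * (norm u / \<rho>) ^ Suc n"
proof -
  define a where "a j = (deriv ^^ j) h 0 / fact j" for j
  define q where "q = norm u / \<rho>"
  have D0: "D \<ge> 0" using order.trans[OF _ D[of 1]] r by simp
  have q: "0 \<le> q" "q \<le> 1/2" using u r by (auto simp: q_def field_simps)
  have "(\<lambda>j. a j * (u - 0) ^ j) sums h u"
    unfolding a_def by (rule holomorphic_power_series[OF h]) (use u r in auto)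
  from sums_split_initial_segment[OF this, of "Suc n"]
  have s: "(\<lambda>j. a (j + Suc n) * u ^ (j + Suc n)) sums (h u - (\<Sum>j\<le>n. a j * u ^ j))"
    by (simp only: diff_zero lessThan_Suc_atMost)
  have b: "norm (a (j + Suc n) * u ^ (j + Suc n)) \<le> D * q ^ Suc n * (1/2) ^ j" for j
  proof -
    have "norm (a (j + Suc n) * u ^ (j + Suc n)) = (norm (a (j + Suc n)) * \<rho> ^ (j + Suc n)) * q ^ (j + Suc n)"
      using r by (simp add: norm_mult norm_power q_def power_divide)
    also have "\<dots> \<le> D * q ^ (j + Suc n)"
      using q D[of "j + Suc n"] unfolding a_def by (intro mult_right_mono) auto
    also have "\<dots> = D * q ^ Suc n * q ^ j" by (simp only: power_add mult_ac)
    also have "\<dots> \<le> D * q ^ Suc n * (1/2) ^ j"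
      using q D0 by (intro mult_left_mono power_mono) auto
    finally show ?thesis .
  qed
  have g: "(\<lambda>j. D * q ^ Suc n * (1/2) ^ j) sums (D * q ^ Suc n * (1 / (1 - 1/2)))"
    by (intro sums_mult geometric_sums) auto
  have "norm (\<Sum>j. a (j + Suc n) * u ^ (j + Suc n)) \<le> (\<Sum>j. D * q ^ Suc n * (1/2) ^ j)"
    by (rule norm_suminf_le[OF b sums_summable[OF g]])
  then show ?thesis using sums_unique[OF s] sums_unique[OF g] by (simp add: a_def q_def mult_ac)
qed

section \<open>Zeros of entire functions and Jensen's formula\<close>

lemma finite_zeros_entire:
  assumes "F holomorphic_on UNIV" "\<exists>z. F z \<noteq> 0"
  shows "finite {w. F w = 0 \<and> norm w \<le> r}"
proof -
  obtain c where "F c \<noteq> 0" using assms(2) by blast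
  have "finite {w \<in> cball 0 r. F w = 0}"
  proof (cases "F constant_on UNIV")
    case True
    then have "{w \<in> cball 0 r. F w = 0} = {}" using \<open>F c \<noteq> 0\<close> by (auto simp: constant_on_def)
    then show ?thesis by (metis finite.emptyI)
  next
    case False
    then show ?thesis by (intro holomorphic_compact_finite_zeros[OF assms(1)]) auto
  qed
  then show ?thesis by (rule rev_finite_subset) auto
qed

lemma zorder_entire:
  assumes "F holomorphic_on UNIV" "\<exists>z. F z \<noteq> 0"
  shows "zorder F w \<ge> 0" "F w = 0 \<Longrightarrow> zorder F w > 0"
  using zorder_exist_zero[OF assms(1) open_UNIV connected_UNIV UNIV_I, of w] assms(2)
  by (auto split: if_splits)

text \<open>
  The local factorization at \<open>x\<close> and the quotient \<open>F z / (z - x)^k\<close> away from \<open>x\<close> are glued along their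
  common domain.
\<close>

lemma divide_zero_entire:
  assumes F: "F holomorphic_on UNIV" "\<exists>z. F z \<noteq> 0"
  obtains G where "G holomorphic_on UNIV" "\<And>z. F z = G z * (z - x) ^ nat (zorder F x)" "G x \<noteq> 0"
proof -
  define k where "k = nat (zorder F x)"
  obtain r g where r: "r > 0" and g: "g holomorphic_on cball x r"
    and fg: "\<And>w. w \<in> cball x r \<Longrightarrow> F w = g w * (w - x) ^ k \<and> g w \<noteq> 0"
    using zorder_exist_zero[OF F(1) open_UNIV connected_UNIV UNIV_I, of x] F(2)
    unfolding k_def by blast
  define G where "G z = (if z = x then g x else F z / (z - x) ^ k)" for z
  have Gg: "G z = g z" if "z \<in> ball x r" for z
    using fg[of z] that by (auto simp: G_def)
  have "G holomorphic_on ball x r"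
    using holomorphic_on_subset[OF g ball_subset_cball] Gg holomorphic_transform by metis
  moreover have "G holomorphic_on - {x}"
  proof (rule holomorphic_transform)
    show "(\<lambda>z. F z / (z - x) ^ k) holomorphic_on - {x}"
      by (intro holomorphic_intros holomorphic_on_subset[OF F(1)]) auto
  qed (auto simp: G_def)
  ultimately have "G holomorphic_on (ball x r \<union> - {x})"
    by (intro holomorphic_on_Un) auto
  also have "ball x r \<union> - {x} = UNIV" using r by auto
  finally have "G holomorphic_on UNIV" .
  moreover have "F z = G z * (z - x) ^ k" for z
    using fg[of x] r by (auto simp: G_def)
  moreover have "G x \<noteq> 0" using fg[of x] r by (simp add: G_def)
  ultimately show ?thesis using that unfolding k_def by blast
qed

lemma zorder_entire_eqI:
  assumes "G holomorphic_on UNIV" "G x \<noteq> 0" "\<And>z. F z = G z * (z - x) ^ k"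
  shows "zorder F x = int k"
  by (rule zorder_eqI[of UNIV x G]) (use assms in auto)

lemma divide_finite_zeros_entire:
  assumes F: "F holomorphic_on UNIV" "\<exists>z. F z \<noteq> 0" and "finite Z"
  obtains G where "G holomorphic_on UNIV"
    "\<And>z. F z = G z * (\<Prod>w\<in>Z. (z - w) ^ nat (zorder F w))" "\<And>w. w \<in> Z \<Longrightarrow> G w \<noteq> 0"
proof -
  have "\<exists>G. G holomorphic_on UNIV \<and> (\<forall>z. F z = G z * (\<Prod>w\<in>Z. (z - w) ^ nat (zorder F w))) \<and>
          (\<forall>w\<in>Z. G w \<noteq> 0)"
    using \<open>finite Z\<close>
  proof (induction Z rule: finite_induct)
    case empty
    then show ?case using F by auto
  next
    case (insert x Z)
    then obtain G where G: "G holomorphic_on UNIV"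
      "\<And>z. F z = G z * (\<Prod>w\<in>Z. (z - w) ^ nat (zorder F w))" "\<And>w. w \<in> Z \<Longrightarrow> G w \<noteq> 0"
      by blast
    have "\<exists>z. G z \<noteq> 0" using F(2) G(2) by auto
    then obtain G' where G': "G' holomorphic_on UNIV"
      "\<And>z. G z = G' z * (z - x) ^ nat (zorder G x)" "G' x \<noteq> 0"
      using divide_zero_entire[OF G(1)] by metis
    have "zorder F x = int (nat (zorder G x))"
    proof (rule zorder_entire_eqI)
      show "(\<lambda>z. G' z * (\<Prod>w\<in>Z. (z - w) ^ nat (zorder F w))) holomorphic_on UNIV"
        by (intro holomorphic_intros G')
      show "G' x * (\<Prod>w\<in>Z. (x - w) ^ nat (zorder F w)) \<noteq> 0"
        using G' insert by auto
    qed (subst G(2), subst G'(2), simp add: mult_ac)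
    then have "nat (zorder F x) = nat (zorder G x)" by simp
    then have "F z = G' z * (\<Prod>w\<in>insert x Z. (z - w) ^ nat (zorder F w))" for z
      using insert G(2)[of z] G'(2)[of z] by (simp add: mult_ac)
    moreover have "G' w \<noteq> 0" if "w \<in> insert x Z" for w
      using that G(3)[of w] G'(2)[of w] G'(3) by auto
    ultimately show ?case using G'(1) by blast
  qed
  then show ?thesis using that by blast
qed

text \<open>
  A Blaschke factor is unimodular on its circle, because \<open>\<rho>\<^sup>2 = z * cnj z\<close> there.
\<close>

lemma norm_blaschke_circle:
  assumes "norm z = \<rho>"
  shows "norm (of_real (\<rho>\<^sup>2) - cnj w * z) = norm (of_real \<rho> * (z - w))"
proof -
  have "of_real (\<rho>\<^sup>2) = z * cnj z" using complex_norm_square[of z] assms by simp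
  then have "of_real (\<rho>\<^sup>2) - cnj w * z = z * cnj (z - w)" by (simp add: algebra_simps)
  then show ?thesis using assms by (metis complex_mod_cnj norm_mult norm_of_real abs_norm_cancel)
qed

text \<open>
  Replacing each zero \<open>w\<close> in the disc by the Blaschke factor of \<open>w\<close> leaves a function without zeros on
  a neighbourhood of the closed disc, hence an exponential \<open>exp H\<close>. It has the modulus of \<open>F\<close> on the
  circle, and at the centre it is larger than \<open>|F 0|\<close> by the amount that appears in Jensen's formula.
  The factors are kept as numerator and denominator so that the identity also holds at the zeros.
\<close>

lemma blaschke_factorization:
  assumes F: "F holomorphic_on UNIV" "F 0 \<noteq> 0" and \<rho>: "\<rho> > 0"
    and sph: "\<And>z. norm z = \<rho> \<Longrightarrow> F z \<noteq> 0"
  defines "Z \<equiv> {w. F w = 0 \<and> norm w < \<rho>}"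
  obtains R H where "R > \<rho>" "H holomorphic_on ball 0 R"
    "\<And>z. norm z < R \<Longrightarrow> F z * (\<Prod>w\<in>Z. (of_real (\<rho>\<^sup>2) - cnj w * z) ^ nat (zorder F w)) =
        exp (H z) * (\<Prod>w\<in>Z. (of_real \<rho> * (z - w)) ^ nat (zorder F w))"
    "\<And>z. norm z = \<rho> \<Longrightarrow> Re (H z) = ln (norm (F z))"
    "Re (H 0) = ln (norm (F 0)) + (\<Sum>w\<in>Z. real (nat (zorder F w)) * ln (\<rho> / norm w))"
proof -
  define m where "m w = nat (zorder F w)" for w
  have ex: "\<exists>z. F z \<noteq> 0" using F by blast
  have finZ: "finite Z"
    by (rule finite_subset[OF _ finite_zeros_entire[OF F(1) ex, of \<rho>]]) (auto simp: Z_def)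
  obtain G where G: "G holomorphic_on UNIV"
    "\<And>z. F z = G z * (\<Prod>w\<in>Z. (z - w) ^ m w)" "\<And>w. w \<in> Z \<Longrightarrow> G w \<noteq> 0"
    using divide_finite_zeros_entire[OF F(1) ex finZ] unfolding m_def by metis
  define g where "g z = G z * (\<Prod>w\<in>Z. ((of_real (\<rho>\<^sup>2) - cnj w * z) / of_real \<rho>) ^ m w)" for z
  have ghol: "g holomorphic_on UNIV"
    unfolding g_def using \<rho> by (intro holomorphic_intros G) auto
  have gnz: "g z \<noteq> 0" if "norm z \<le> \<rho>" for z
  proof -
    have "G z \<noteq> 0"
      using G(2,3)[of z] that sph[of z] by (cases "z \<in> Z") (auto simp: Z_def)
    moreover have "of_real (\<rho>\<^sup>2) - cnj w * z \<noteq> 0" if "w \<in> Z" for w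
    proof
      assume "of_real (\<rho>\<^sup>2) - cnj w * z = 0"
      then have "norm (of_real (\<rho>\<^sup>2) :: complex) = norm (cnj w * z)" by simp
      then have "\<rho>\<^sup>2 = norm w * norm z" by (simp add: norm_mult norm_power)
      moreover have "norm w * norm z \<le> norm w * \<rho>" 
        using \<open>norm z \<le> \<rho>\<close> by (intro mult_left_mono) auto
      moreover have "norm w * \<rho> < \<rho> * \<rho>" using that \<rho> by (auto simp: Z_def)
      ultimately show False by (simp add: power2_eq_square)
    qed
    ultimately show ?thesis using \<rho> finZ by (auto simp: g_def)
  qed
  \<comment> \<open>By compactness \<open>g\<close> has no zeros on a slightly larger disc, where it has a logarithm.\<close>
  have "open {z. g z \<noteq> 0}"
    using holomorphic_on_imp_continuous_on[OF ghol] by (simp add: open_Collect_neq)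
  moreover have "cball 0 \<rho> \<subseteq> {z. g z \<noteq> 0}" using gnz by auto
  ultimately obtain e where e: "e > 0" "(\<Union>x\<in>cball 0 \<rho>. ball x e) \<subseteq> {z. g z \<noteq> 0}"
    using compact_subset_open_imp_ball_epsilon_subset[OF compact_cball] by metis
  define R where "R = \<rho> + e"
  have R: "R > \<rho>" using e by (simp add: R_def)
  have gnzR: "g z \<noteq> 0" if "norm z < R" for z
  proof (cases "norm z \<le> \<rho>")
    case False
    then have z0: "norm z > \<rho>" "norm z > 0" using \<rho> by linarith+
    define x where "x = of_real (\<rho> / norm z) * z"
    have "norm x = \<bar>\<rho> / norm z\<bar> * norm z" by (simp only: x_def norm_mult norm_of_real)
    then have "norm x = \<rho>" using \<rho> z0 by simp
    have "z - x = of_real (1 - \<rho> / norm z) * z" by (simp add: x_def algebra_simps)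
    then have "norm (z - x) = \<bar>1 - \<rho> / norm z\<bar> * norm z" by (simp only: norm_mult norm_of_real)
    also have "\<dots> = norm z - \<rho>" using z0 \<rho> by (simp add: abs_if field_simps)
    finally have "dist x z < e" using that by (simp add: R_def dist_norm norm_minus_commute[of x z])
    then have "z \<in> (\<Union>x\<in>cball 0 \<rho>. ball x e)"
      using \<open>norm x = \<rho>\<close> by (intro UN_I[of x]) auto
    then show ?thesis using e(2) by blast
  qed (use gnz in auto)
  have "g holomorphic_on ball 0 R" by (rule holomorphic_on_subset[OF ghol]) simp
  then have "\<exists>H. H holomorphic_on ball 0 R \<and> (\<forall>z\<in>ball 0 R. exp (H z) = g z)"
    by (rule holomorphic_logarithm_exists[OF convex_ball open_ball, of g 0 R 0])
       (use gnzR \<rho> R in auto)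
  then obtain H where H: "H holomorphic_on ball 0 R" "\<And>z. z \<in> ball 0 R \<Longrightarrow> exp (H z) = g z"
    by blast
  have eq: "F z * (\<Prod>w\<in>Z. (of_real (\<rho>\<^sup>2) - cnj w * z) ^ m w) =
        exp (H z) * (\<Prod>w\<in>Z. (of_real \<rho> * (z - w)) ^ m w)" if "norm z < R" for z
  proof -
    have 1: "exp (H z) = g z" using H(2) that by simp
    have 2: "(\<Prod>w\<in>Z. (z - w) ^ m w) * (\<Prod>w\<in>Z. (of_real (\<rho>\<^sup>2) - cnj w * z) ^ m w) =
      (\<Prod>w\<in>Z. ((of_real (\<rho>\<^sup>2) - cnj w * z) / of_real \<rho>) ^ m w) * (\<Prod>w\<in>Z. (of_real \<rho> * (z - w)) ^ m w)"
      unfolding prod.distrib [symmetric] power_mult_distrib [symmetric]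
      using \<rho> by (intro prod.cong refl arg_cong2[of _ _ _ _ "(^)"]) simp_all
    show ?thesis unfolding 1 g_def G(2)[of z] mult.assoc 2 ..
  qed
  have onsph: "Re (H z) = ln (norm (F z))" if "norm z = \<rho>" for z
  proof -
    have "norm (\<Prod>w\<in>Z. (of_real (\<rho>\<^sup>2) - cnj w * z) ^ m w) = norm (\<Prod>w\<in>Z. (of_real \<rho> * (z - w)) ^ m w)"
      unfolding prod_norm [symmetric] norm_power using norm_blaschke_circle[OF that] by simp
    moreover have "norm (\<Prod>w\<in>Z. (of_real \<rho> * (z - w)) ^ m w) \<noteq> 0"
      using finZ that \<rho> by (auto simp: Z_def)
    ultimately have "norm (F z) = norm (exp (H z))"
      using arg_cong[OF eq, of z norm] that R by (simp add: norm_mult)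
    then show ?thesis by simp
  qed
  have Z0: "w \<noteq> 0" if "w \<in> Z" for w using that F(2) by (auto simp: Z_def)
  have "norm (F 0) * (\<Prod>w\<in>Z. (\<rho>\<^sup>2) ^ m w) = exp (Re (H 0)) * (\<Prod>w\<in>Z. (\<rho> * norm w) ^ m w)"
    using arg_cong[OF eq[of 0], of norm] \<rho> R
    by (simp add: norm_mult norm_power flip: prod_norm)
  then have "exp (Re (H 0)) = norm (F 0) * (\<Prod>w\<in>Z. (\<rho> / norm w) ^ m w)"
    using \<rho> Z0 finZ
    by (simp add: power_divide power_mult_distrib prod_dividef prod.distrib field_simps power2_eq_square)
  then have "Re (H 0) = ln (norm (F 0) * (\<Prod>w\<in>Z. (\<rho> / norm w) ^ m w))"
    by (metis ln_exp)
  also have "\<dots> = ln (norm (F 0)) + ln (\<Prod>w\<in>Z. (\<rho> / norm w) ^ m w)"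
    using F(2) Z0 \<rho> by (intro ln_mult_pos prod_pos) auto
  also have "ln (\<Prod>w\<in>Z. (\<rho> / norm w) ^ m w) = (\<Sum>w\<in>Z. real (m w) * ln (\<rho> / norm w))"
    using Z0 \<rho> finZ by (subst ln_prod) (auto simp: ln_realpow)
  finally show ?thesis using that[OF R H(1) _ onsph] eq unfolding m_def by blast
qed

lemma jensen_formula:
  assumes F: "F holomorphic_on UNIV" "F 0 \<noteq> 0" and \<rho>: "\<rho> > 0"
    and sph: "\<And>z. norm z = \<rho> \<Longrightarrow> F z \<noteq> 0"
  shows "circle_mean (\<lambda>z. ln (norm (F z))) \<rho> = ln (norm (F 0)) +
           (\<Sum>w | F w = 0 \<and> norm w < \<rho>. real (nat (zorder F w)) * ln (\<rho> / norm w))"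
proof (rule blaschke_factorization[OF F \<rho> sph])
  fix R H assume H: "R > \<rho>" "H holomorphic_on ball 0 R"
    and H': "\<And>z. norm z = \<rho> \<Longrightarrow> Re (H z) = ln (norm (F z))"
    "Re (H 0) = ln (norm (F 0)) +
       (\<Sum>w | F w = 0 \<and> norm w < \<rho>. real (nat (zorder F w)) * ln (\<rho> / norm w))"
  have "circle_mean (\<lambda>z. ln (norm (F z))) \<rho> = circle_mean (\<lambda>z. Re (H z)) \<rho>"
    using H'(1) \<rho> by (intro circle_mean_cong) auto
  with H'(2) circle_mean_Re[OF H(2) \<rho> H(1)] show ?thesis by simp
qed

lemma jensen_sum_nonneg:
  assumes "F 0 \<noteq> 0"
  shows "(\<Sum>w | F w = 0 \<and> norm w < \<rho>. real (nat (zorder F w)) * ln (\<rho> / norm w)) \<ge> 0"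
proof (intro sum_nonneg mult_nonneg_nonneg)
  fix w assume "w \<in> {w. F w = 0 \<and> norm w < \<rho>}"
  with assms have "w \<noteq> 0" "norm w < \<rho>" by auto
  then have "1 \<le> \<rho> / norm w" by (simp add: le_divide_eq)
  then show "ln (\<rho> / norm w) \<ge> 0" by (rule ln_ge_zero)
qed simp

text \<open>
  This is the lower bound for the mean of \<open>ln |F|\<close> that lets a characteristic of \<open>1/F\<close> be replaced
  by one of \<open>F\<close>.
\<close>

lemma jensen_inequality:
  assumes F: "F holomorphic_on UNIV" "F 0 \<noteq> 0" and \<rho>: "\<rho> > 0"
    and sph: "\<And>z. norm z = \<rho> \<Longrightarrow> F z \<noteq> 0"
  shows "ln (norm (F 0)) \<le> circle_mean (\<lambda>z. ln (norm (F z))) \<rho>"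
  using jensen_formula[OF assms] jensen_sum_nonneg[of F \<rho>] F(2) by linarith

text \<open>
  In Jensen's formula each zero in the disc of half the radius contributes at least \<open>ln 2\<close>.
\<close>

lemma zero_count_le_nevanlinna_T:
  assumes F: "F holomorphic_on UNIV" "F 0 \<noteq> 0" and \<rho>: "\<rho> > 0"
    and sph: "\<And>z. norm z = \<rho> \<Longrightarrow> F z \<noteq> 0"
    and r: "2 * r \<le> \<rho>"
  shows "(\<Sum>w | F w = 0 \<and> norm w \<le> r. real (nat (zorder F w))) * ln 2 \<le> nevanlinna_T F \<rho> - ln (norm (F 0))"
proof -
  have ex: "\<exists>z. F z \<noteq> 0" using F by blast
  have cont: "continuous_on A F" for A
    using holomorphic_on_imp_continuous_on[OF F(1)] continuous_on_subset by blast
  have "(\<Sum>w | F w = 0 \<and> norm w \<le> r. real (nat (zorder F w))) * ln 2 =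
        (\<Sum>w | F w = 0 \<and> norm w \<le> r. real (nat (zorder F w)) * ln 2)"
    by (simp add: sum_distrib_right)
  also have "\<dots> \<le> (\<Sum>w | F w = 0 \<and> norm w \<le> r. real (nat (zorder F w)) * ln (\<rho> / norm w))"
  proof (intro sum_mono mult_left_mono)
    fix w assume "w \<in> {w. F w = 0 \<and> norm w \<le> r}"
    with F(2) have "w \<noteq> 0" "norm w \<le> r" by auto
    then show "ln 2 \<le> ln (\<rho> / norm w)"
      using r \<rho> by (subst ln_le_cancel_iff) (auto simp: field_simps)
  qed auto
  also have "\<dots> \<le> (\<Sum>w | F w = 0 \<and> norm w < \<rho>. real (nat (zorder F w)) * ln (\<rho> / norm w))"
  proof (rule sum_mono2)
    show "finite {w. F w = 0 \<and> norm w < \<rho>}"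
      by (rule finite_subset[OF _ finite_zeros_entire[OF F(1) ex, of \<rho>]]) auto
    show "{w. F w = 0 \<and> norm w \<le> r} \<subseteq> {w. F w = 0 \<and> norm w < \<rho>}"
      using r \<rho> by auto
  next
    fix w assume "w \<in> {w. F w = 0 \<and> norm w < \<rho>} - {w. F w = 0 \<and> norm w \<le> r}"
    with F(2) have "w \<noteq> 0" "norm w < \<rho>" by auto
    then show "0 \<le> real (nat (zorder F w)) * ln (\<rho> / norm w)"
      by (intro mult_nonneg_nonneg ln_ge_zero) (auto simp: field_simps)
  qed
  also have "\<dots> = circle_mean (\<lambda>z. ln (norm (F z))) \<rho> - ln (norm (F 0))"
    using jensen_formula[OF F \<rho> sph] by simp
  also have "circle_mean (\<lambda>z. ln (norm (F z))) \<rho> \<le> circle_mean (\<lambda>z. log_plus (norm (F z))) \<rho>"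
    using \<rho> sph
    by (intro circle_mean_mono continuous_on_log_plus_norm cont continuous_intros)
       (auto simp: log_plus_def)
  also have "\<dots> = nevanlinna_T F \<rho>"
    using nevanlinna_T_eq_circle_mean[OF cont \<rho>] by simp
  finally show ?thesis by simp
qed

section \<open>Logarithmic derivatives of entire functions of finite order\<close>

text \<open>
  Among the midpoints of \<open>card P + 1\<close> equal pieces of the interval, each point of \<open>P\<close> is close to at most
  one.
\<close>

lemma avoid_finite_set_by_gap:
  fixes P :: "real set"
  assumes "finite P"
  shows "\<exists>r\<in>{x..x+1}. \<forall>p\<in>P. \<bar>p - r\<bar> \<ge> 1 / (2 * (real (card P) + 1))"
proof (rule ccontr)
  define k where "k = card P"
  define \<delta> where "\<delta> = 1 / (2 * (real k + 1))"
  define r where "r i = x + (2 * real i + 1) * \<delta>" for i :: nat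
  assume neg: "\<not> ?thesis"
  have \<delta>: "\<delta> > 0" "2 * (real k + 1) * \<delta> = 1" by (simp_all add: \<delta>_def)
  have "\<forall>i\<in>{..k}. \<exists>p\<in>P. \<bar>p - r i\<bar> < \<delta>"
  proof
    fix i assume "i \<in> {..k}"
    then have "(2 * real i + 1) * \<delta> \<le> 2 * (real k + 1) * \<delta>" using \<delta>(1) by (intro mult_right_mono) auto
    then have "(2 * real i + 1) * \<delta> \<le> 1" unfolding \<delta>(2) .
    then have "r i \<in> {x..x+1}" using \<delta>(1) by (simp add: r_def)
    then show "\<exists>p\<in>P. \<bar>p - r i\<bar> < \<delta>" using neg unfolding k_def \<delta>_def by force
  qed
  then obtain p where p: "\<And>i. i \<le> k \<Longrightarrow> p i \<in> P \<and> \<bar>p i - r i\<bar> < \<delta>" by (metis atMost_iff)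
  have "inj_on p {..k}"
  proof (rule inj_onI)
    fix i j assume ij: "i \<in> {..k}" "j \<in> {..k}" "p i = p j"
    then have "\<bar>r i - r j\<bar> < 2 * \<delta>" using p[of i] p[of j] by auto
    moreover have "\<bar>r i - r j\<bar> = 2 * \<delta> * \<bar>real i - real j\<bar>"
    proof -
      have "r i - r j = 2 * \<delta> * (real i - real j)" by (simp add: r_def algebra_simps)
      then show ?thesis using \<delta>(1) by (simp add: abs_mult)
    qed
    ultimately have "\<bar>real i - real j\<bar> < 1" using \<delta>(1) by simp
    then show "i = j" by linarith
  qed
  then have "card {..k} \<le> card P" using p assms by (intro card_inj_on_le[of p]) auto
  then show False by (simp add: k_def)
qed

text \<open>
  Jensen's formula and its consequences are stated for circles without zeros; this lemma supplies
  such circles.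
\<close>

lemma zero_free_circle:
  assumes "F holomorphic_on UNIV" "\<exists>z. F z \<noteq> 0"
  obtains \<rho> where "x \<le> \<rho>" "\<rho> \<le> x + 1" "\<And>z. norm z = \<rho> \<Longrightarrow> F z \<noteq> 0"
proof -
  define P where "P = norm ` {w. F w = 0 \<and> norm w \<le> x + 1}"
  have "finite P" unfolding P_def by (intro finite_imageI finite_zeros_entire assms)
  then obtain r where r: "r \<in> {x..x+1}" "\<And>p. p \<in> P \<Longrightarrow> \<bar>p - r\<bar> \<ge> 1 / (2 * (real (card P) + 1))"
    using avoid_finite_set_by_gap by metis
  have "F z \<noteq> 0" if "norm z = r" for z
  proof
    assume "F z = 0"
    then have "norm z \<in> P" using that r(1) by (auto simp: P_def)
    from r(2)[OF this] that show False by (simp add: field_simps)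
  qed
  with r(1) that show ?thesis by auto
qed

lemma continuous_on_entire: "F holomorphic_on UNIV \<Longrightarrow> continuous_on S F"
  using holomorphic_on_imp_continuous_on continuous_on_subset by blast

lemma log_derivative_prod_power:
  fixes \<phi> :: "complex \<Rightarrow> complex \<Rightarrow> complex"
  assumes "\<And>w. w \<in> Z \<Longrightarrow> \<phi> w z \<noteq> 0"
    and "\<And>w. w \<in> Z \<Longrightarrow> (\<phi> w has_field_derivative \<phi>' w) (at z)"
  shows "((\<lambda>u. \<Prod>w\<in>Z. \<phi> w u ^ m w) has_field_derivative
           (\<Prod>w\<in>Z. \<phi> w z ^ m w) * (\<Sum>w\<in>Z. of_nat (m w) * \<phi>' w / \<phi> w z)) (at z)"
proof -
  have "((\<lambda>u. \<Prod>w\<in>Z. \<phi> w u ^ m w) has_field_derivative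
      (\<Prod>w\<in>Z. \<phi> w z ^ m w) * (\<Sum>w\<in>Z. of_nat (m w) * \<phi> w z ^ (m w - 1) * \<phi>' w / \<phi> w z ^ m w)) (at z)"
  proof (rule has_field_derivative_prod')
    fix w assume w: "w \<in> Z"
    show "\<phi> w z ^ m w \<noteq> 0" using assms(1)[OF w] by simp
    show "((\<lambda>u. \<phi> w u ^ m w) has_field_derivative of_nat (m w) * \<phi> w z ^ (m w - 1) * \<phi>' w) (at z)"
      by (rule derivative_eq_intros assms(2) w refl)+ simp
  qed
  also have "(\<Sum>w\<in>Z. of_nat (m w) * \<phi> w z ^ (m w - 1) * \<phi>' w / \<phi> w z ^ m w) =
             (\<Sum>w\<in>Z. of_nat (m w) * \<phi>' w / \<phi> w z)"
  proof (intro sum.cong refl)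
    fix w assume w: "w \<in> Z"
    show "of_nat (m w) * \<phi> w z ^ (m w - 1) * \<phi>' w / \<phi> w z ^ m w = of_nat (m w) * \<phi>' w / \<phi> w z"
      using assms(1)[OF w] by (cases "m w") auto
  qed
  finally show ?thesis .
qed

lemma holomorphic_oscillation_bound:
  assumes h: "h holomorphic_on ball 0 R" and r: "0 < \<rho>" "\<rho> < R" and u: "2 * norm u \<le> \<rho>"
    and D: "\<And>j. j > 0 \<Longrightarrow> norm ((deriv ^^ j) h 0 / fact j) * \<rho> ^ j \<le> D"
  shows "norm (h u - h 0) \<le> D"
proof -
  have D0: "D \<ge> 0" using order.trans[OF _ D[of 1]] r by simp
  have "norm (h u - h 0) \<le> 2 * D * (norm u / \<rho>)"
    using taylor_tail_bound[OF h r u D, of 0] by simp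
  also have "\<dots> \<le> 2 * D * (1 / 2)"
    using u r D0 by (intro mult_left_mono) (auto simp: field_simps)
  finally show ?thesis by simp
qed

text \<open>
  By the Blaschke factorization \<open>F'/F\<close> is \<open>H'\<close> plus the sum over the zeros \<open>w\<close> of
  \<open>1/(z - w) + cnj w / (\<rho>\<^sup>2 - cnj w z)\<close>, counted with multiplicity. The first summand is at most \<open>1/\<epsilon>\<close>, the second at most
  \<open>2/\<rho>\<close>. For \<open>H'\<close>, the coefficients of \<open>H\<close> are bounded by the characteristic and \<open>ln |F 0|\<close>, which
  bounds the oscillation of \<open>H\<close> on the disc of half the radius.
\<close>

lemma log_derivative_bound:
  assumes F: "F holomorphic_on UNIV" "F 0 \<noteq> 0" and \<rho>: "\<rho> > 0"
    and sph: "\<And>z. norm z = \<rho> \<Longrightarrow> F z \<noteq> 0"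
    and z: "4 * norm z \<le> \<rho>" "F z \<noteq> 0" and \<epsilon>: "\<epsilon> > 0"
    and dist: "\<And>w. F w = 0 \<Longrightarrow> norm w < \<rho> \<Longrightarrow> \<epsilon> \<le> norm (z - w)"
  shows "norm (deriv F z / F z) \<le>
     (\<Sum>w | F w = 0 \<and> norm w < \<rho>. real (nat (zorder F w))) * (1 / \<epsilon> + 2 / \<rho>) +
     4 * (4 * nevanlinna_T F \<rho> - 2 * ln (norm (F 0))) / \<rho>"
proof (rule blaschke_factorization[OF F \<rho> sph])
  define Z where "Z = {w. F w = 0 \<and> norm w < \<rho>}"
  define m where "m w = nat (zorder F w)" for w
  define D where "D = 4 * nevanlinna_T F \<rho> - 2 * ln (norm (F 0))"
  fix R H assume R: "R > \<rho>" and H: "H holomorphic_on ball 0 R"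
    and eq0: "\<And>z. norm z < R \<Longrightarrow>
      F z * (\<Prod>w | F w = 0 \<and> norm w < \<rho>. (of_real (\<rho>\<^sup>2) - cnj w * z) ^ nat (zorder F w)) =
      exp (H z) * (\<Prod>w | F w = 0 \<and> norm w < \<rho>. (of_real \<rho> * (z - w)) ^ nat (zorder F w))"
    and ReH: "\<And>z. norm z = \<rho> \<Longrightarrow> Re (H z) = ln (norm (F z))"
    and H0: "Re (H 0) = ln (norm (F 0)) +
       (\<Sum>w | F w = 0 \<and> norm w < \<rho>. real (nat (zorder F w)) * ln (\<rho> / norm w))"
  have ex: "\<exists>z. F z \<noteq> 0" using F by blast
  have finZ: "finite Z"
    by (rule finite_subset[OF _ finite_zeros_entire[OF F(1) ex, of \<rho>]]) (auto simp: Z_def)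
  have coef: "norm ((deriv ^^ j) H 0 / fact j) * \<rho> ^ j \<le> D" if "j > 0" for j
  proof -
    have "norm ((deriv ^^ j) H 0 / fact j) * \<rho> ^ j \<le>
           4 * circle_mean (\<lambda>z. max 0 (Re (H z))) \<rho> - 2 * Re (H 0)"
      by (rule taylor_coefficient_le_circle_mean[OF H \<rho> R that])
    also have "circle_mean (\<lambda>z. max 0 (Re (H z))) \<rho> = circle_mean (\<lambda>z. log_plus (norm (F z))) \<rho>"
      by (rule circle_mean_cong[OF \<rho>]) (simp add: ReH log_plus_def)
    also have "\<dots> = nevanlinna_T F \<rho>"
      by (rule nevanlinna_T_eq_circle_mean [symmetric, OF continuous_on_entire[OF F(1)] \<rho>])
    finally show ?thesis using H0 jensen_sum_nonneg[of F \<rho>] F(2) by (simp add: D_def)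
  qed
  have "norm (deriv H z) \<le> D * 4 / \<rho>"
  proof -
    have sub: "cball z (\<rho> / 4) \<subseteq> ball 0 R"
    proof
      fix u assume "u \<in> cball z (\<rho> / 4)"
      then have "norm u \<le> norm z + \<rho> / 4"
        using norm_triangle_ineq2[of u z] by (simp add: dist_norm norm_minus_commute)
      then show "u \<in> ball 0 R" using z R \<rho> by simp
    qed
    have "norm ((deriv ^^ 1) (\<lambda>u. H u - H 0) z) \<le> fact 1 * D / (\<rho> / 4) ^ 1"
    proof (rule Cauchy_inequality)
      have "(\<lambda>u. H u - H 0) holomorphic_on ball 0 R" by (intro holomorphic_intros H)
      then have hol: "(\<lambda>u. H u - H 0) holomorphic_on cball z (\<rho> / 4)"
        using sub by (rule holomorphic_on_subset)
      show "(\<lambda>u. H u - H 0) holomorphic_on ball z (\<rho> / 4)"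
        by (rule holomorphic_on_subset[OF hol ball_subset_cball])
      show "continuous_on (cball z (\<rho> / 4)) (\<lambda>u. H u - H 0)"
        by (rule holomorphic_on_imp_continuous_on[OF hol])
      fix u assume "norm (z - u) = \<rho> / 4"
      then have "norm u \<le> norm z + \<rho> / 4"
        using norm_triangle_ineq2[of u z] by (simp add: norm_minus_commute)
      then show "norm (H u - H 0) \<le> D"
        using z by (intro holomorphic_oscillation_bound[OF H \<rho> R _ coef]) auto
    qed (use \<rho> in auto)
    moreover have "deriv (\<lambda>u. H u - H 0) z = deriv H z"
    proof -
      have "(H has_field_derivative deriv H z) (at z)"
        by (rule holomorphic_derivI[OF H]) (use z \<rho> R in auto)
      then have "((\<lambda>u. H u - H 0) has_field_derivative deriv H z - 0) (at z)"
        by (intro derivative_intros)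
      then show ?thesis by (simp add: DERIV_imp_deriv)
    qed
    ultimately show ?thesis by (simp add: field_simps)
  qed
  then have dH: "norm (deriv H z) \<le> 4 * D / \<rho>" by (simp add: mult.commute)
  define X where "X w u = of_real (\<rho>\<^sup>2) - cnj w * u" for w u :: complex
  define Y where "Y w u = of_real \<rho> * (u - w)" for w u :: complex
  have Xlow: "\<rho> * (\<rho> / 2) \<le> norm (X w z)" if "w \<in> Z" for w
  proof -
    have "norm (cnj w * z) = norm w * norm z" by (simp add: norm_mult)
    also have "\<dots> \<le> \<rho> * (\<rho> / 4)" using that z \<rho> by (intro mult_mono) (auto simp: Z_def)
    finally have "norm (cnj w * z) \<le> \<rho> * \<rho> / 4" by simp
    moreover have "norm (of_real (\<rho>\<^sup>2) :: complex) - norm (cnj w * z) \<le> norm (X w z)"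
      unfolding X_def by (rule norm_triangle_ineq2)
    moreover have "norm (of_real (\<rho>\<^sup>2) :: complex) = \<rho> * \<rho>" 
      by (simp only: norm_of_real power2_eq_square) simp
    moreover have "0 \<le> \<rho> * \<rho>" by simp
    ultimately show ?thesis by linarith
  qed
  have Xnz: "X w z \<noteq> 0" if "w \<in> Z" for w
    using Xlow[OF that] \<rho> by (auto simp: mult_le_0_iff)
  have Ynz: "Y w z \<noteq> 0" if "w \<in> Z" for w
    using that z(2) \<rho> by (auto simp: Y_def Z_def)
  define PX where "PX u = (\<Prod>w\<in>Z. X w u ^ m w)" for u
  define PY where "PY u = (\<Prod>w\<in>Z. Y w u ^ m w)" for u
  define SX where "SX = (\<Sum>w\<in>Z. of_nat (m w) * (- cnj w) / X w z)"
  define SY where "SY = (\<Sum>w\<in>Z. of_nat (m w) * of_real \<rho> / Y w z)"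
  have eq: "F u * PX u = exp (H u) * PY u" if "norm u < R" for u
    using eq0[OF that] by (simp only: PX_def PY_def X_def Y_def Z_def m_def)
  have dPX: "(PX has_field_derivative PX z * SX) (at z)"
    unfolding PX_def [abs_def] SX_def
    by (rule log_derivative_prod_power[of Z X z "\<lambda>w. - cnj w"])
       (use Xnz in \<open>auto simp: X_def [abs_def] intro!: derivative_eq_intros\<close>)
  have dPY: "(PY has_field_derivative PY z * SY) (at z)"
    unfolding PY_def [abs_def] SY_def
    by (rule log_derivative_prod_power[of Z Y z "\<lambda>_. of_real \<rho>"])
       (use Ynz in \<open>auto simp: Y_def [abs_def] intro!: derivative_eq_intros\<close>)
  have dF: "(F has_field_derivative deriv F z) (at z)"
    by (rule holomorphic_derivI[OF F(1)]) auto
  have dH': "(H has_field_derivative deriv H z) (at z)"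
    by (rule holomorphic_derivI[OF H]) (use z \<rho> R in auto)
  have 1: "((\<lambda>u. F u * PX u) has_field_derivative deriv F z * PX z + F z * (PX z * SX)) (at z)"
    by (rule derivative_eq_intros dF dPX refl)+ (simp add: algebra_simps)
  have 2: "((\<lambda>u. exp (H u) * PY u) has_field_derivative
      exp (H z) * deriv H z * PY z + exp (H z) * (PY z * SY)) (at z)"
    by (rule derivative_eq_intros dH' dPY refl)+ (simp add: algebra_simps)
  have "((\<lambda>u. F u * PX u) has_field_derivative
      exp (H z) * deriv H z * PY z + exp (H z) * (PY z * SY)) (at z)"
    by (rule has_field_derivative_transform_within_open[OF 2 open_ball, of 0 R])
       (use z \<rho> R eq in auto)
  with 1 have "deriv F z * PX z + F z * (PX z * SX) =
      exp (H z) * deriv H z * PY z + exp (H z) * (PY z * SY)"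
    by (rule DERIV_unique)
  also have "\<dots> = (exp (H z) * PY z) * (deriv H z + SY)" by (simp add: algebra_simps)
  also have "exp (H z) * PY z = F z * PX z" using eq[of z] z \<rho> R by simp
  finally have "deriv F z * PX z = F z * PX z * (deriv H z + SY - SX)" by (simp add: algebra_simps)
  moreover have "PX z \<noteq> 0" using Xnz finZ by (simp add: PX_def)
  ultimately have "deriv F z = F z * (deriv H z + SY - SX)" by simp
  then have "deriv F z / F z = deriv H z + SY - SX" using z(2) by simp
  also have "norm \<dots> \<le> norm (deriv H z) + norm SY + norm SX"
    by (meson norm_triangle_ineq4 norm_triangle_ineq order.trans add_mono order_refl)
  also have "norm SY \<le> (\<Sum>w\<in>Z. real (m w)) * (1 / \<epsilon>)"
    unfolding SY_def sum_distrib_right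
  proof (rule sum_norm_le)
    fix w assume w: "w \<in> Z"
    have "norm (of_nat (m w) * of_real \<rho> / Y w z) = real (m w) / norm (z - w)"
      using \<rho> by (simp add: Y_def norm_mult norm_divide)
    also have "\<dots> \<le> real (m w) / \<epsilon>"
      using dist[of w] w \<epsilon> by (intro divide_left_mono mult_pos_pos) (auto simp: Z_def intro: less_le_trans)
    finally show "norm (of_nat (m w) * of_real \<rho> / Y w z) \<le> real (m w) * (1 / \<epsilon>)" by simp
  qed
  also have "norm SX \<le> (\<Sum>w\<in>Z. real (m w)) * (2 / \<rho>)"
    unfolding SX_def sum_distrib_right
  proof (rule sum_norm_le)
    fix w assume w: "w \<in> Z"
    have "norm (of_nat (m w) * (- cnj w) / X w z) = real (m w) * (norm w / norm (X w z))"
      by (simp add: norm_mult norm_divide)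
    also have "\<dots> \<le> real (m w) * (\<rho> / (\<rho> * (\<rho> / 2)))"
      using w \<rho> Xlow[OF w] by (intro mult_left_mono frac_le) (auto simp: Z_def)
    finally show "norm (of_nat (m w) * (- cnj w) / X w z) \<le> real (m w) * (2 / \<rho>)" using \<rho> by simp
  qed
  finally show ?thesis
    using dH unfolding D_def [symmetric] Z_def m_def by (simp add: algebra_simps)
qed

lemma zero_count_polynomial:
  assumes F: "F holomorphic_on UNIV" "F 0 \<noteq> 0"
    and T: "\<And>r. r \<ge> r0 \<Longrightarrow> nevanlinna_T F r \<le> r ^ K"
  shows "\<exists>C\<ge>0. \<forall>R\<ge>max 1 r0. (\<Sum>w | F w = 0 \<and> norm w \<le> R. real (nat (zorder F w))) \<le> C * R ^ K"
proof -
  define C where "C = (3 ^ K + \<bar>ln (norm (F 0))\<bar>) / ln 2"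
  have "(\<Sum>w | F w = 0 \<and> norm w \<le> R. real (nat (zorder F w))) \<le> C * R ^ K" if R: "R \<ge> 1" "R \<ge> r0" for R
  proof -
    obtain \<rho> where \<rho>: "2 * R \<le> \<rho>" "\<rho> \<le> 2 * R + 1" "\<And>z. norm z = \<rho> \<Longrightarrow> F z \<noteq> 0"
      using zero_free_circle[OF F(1)] F(2) by metis
    have "(\<Sum>w | F w = 0 \<and> norm w \<le> R. real (nat (zorder F w))) * ln 2 \<le> nevanlinna_T F \<rho> - ln (norm (F 0))"
      using R \<rho> by (intro zero_count_le_nevanlinna_T F) auto
    also have "\<dots> \<le> \<rho> ^ K + \<bar>ln (norm (F 0))\<bar>"
      using T[of \<rho>] \<rho> R by simp
    also have "\<dots> \<le> (3 * R) ^ K + \<bar>ln (norm (F 0))\<bar> * R ^ K"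
      using \<rho> R by (intro add_mono power_mono) (auto simp: mult_le_cancel_left1)
    also have "\<dots> = C * R ^ K * ln 2" 
    proof -
      have "C * ln 2 = 3 ^ K + \<bar>ln (norm (F 0))\<bar>" by (simp add: C_def)
      moreover have "C * R ^ K * ln 2 = (C * ln 2) * R ^ K" by (simp only: mult_ac)
      ultimately show ?thesis by (simp add: power_mult_distrib distrib_right)
    qed
    finally show ?thesis by simp
  qed
  moreover have "C \<ge> 0" by (simp add: C_def)
  ultimately show ?thesis by auto
qed

text \<open>
  The bound is needed on an annulus around the circle, not only on the circle, so that Cauchy's
  estimate can be applied to \<open>F'/F\<close> afterwards. Its width \<open>\<epsilon>\<close> may be a negative power of \<open>x\<close>, since this
  costs only another power of \<open>x\<close>.
\<close>

lemma log_derivative_polynomial_near_circles: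
  assumes F: "F holomorphic_on UNIV" "F 0 \<noteq> 0"
    and T: "\<And>r. r \<ge> r0 \<Longrightarrow> nevanlinna_T F r \<le> r ^ K"
  shows "\<exists>C x0. C \<ge> 1 \<and> x0 \<ge> 1 \<and> (\<forall>x\<ge>x0.
    \<exists>r\<in>{x..x+1}. \<exists>\<epsilon>>0. \<epsilon> \<le> 1 \<and> 1 / \<epsilon> \<le> C * x ^ (2 * K) \<and>
       (\<forall>z. \<bar>norm z - r\<bar> \<le> \<epsilon> \<longrightarrow> F z \<noteq> 0 \<and> norm (deriv F z / F z) \<le> C * x ^ (2 * K)))"
proof -
  have ex: "\<exists>z. F z \<noteq> 0" using F by blast
  obtain C1 where C1: "C1 \<ge> 0" 
    "\<And>R. R \<ge> 1 \<Longrightarrow> R \<ge> r0 \<Longrightarrow> (\<Sum>w | F w = 0 \<and> norm w \<le> R. real (nat (zorder F w))) \<le> C1 * R ^ K"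
    using zero_count_polynomial[of F r0 K, OF F T] by auto
  define c where "c = C1 * 9 ^ K"
  define L where "L = \<bar>ln (norm (F 0))\<bar>"
  define C where "C = 4 * (c + 1) + c * (4 * (c + 1) + 2) + 4 * (4 * 9 ^ K + 2 * L)"
  have c0: "c \<ge> 0" "L \<ge> 0" using C1 by (simp_all add: c_def L_def)
  have C: "C \<ge> 4 * (c + 1)" "C \<ge> 1" using c0 by (auto simp: C_def intro!: add_nonneg_nonneg mult_nonneg_nonneg)
  define x0 where "x0 = max 2 r0"
  have "\<exists>r\<in>{x..x+1}. \<exists>\<epsilon>>0. \<epsilon> \<le> 1 \<and> 1 / \<epsilon> \<le> C * x ^ (2 * K) \<and>
       (\<forall>z. \<bar>norm z - r\<bar> \<le> \<epsilon> \<longrightarrow> F z \<noteq> 0 \<and> norm (deriv F z / F z) \<le> C * x ^ (2 * K))"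
    if x: "x \<ge> x0" for x
  proof -
    have x2: "x \<ge> 2" "x \<ge> r0" using x by (auto simp: x0_def)
    define y where "y = x ^ K"
    have y: "y \<ge> 1" "x ^ (2 * K) = y\<^sup>2" using x2 by (auto simp: y_def mult.commute power_mult)
    have yy: "y \<le> y\<^sup>2" "1 \<le> y\<^sup>2" using self_le_power[OF y(1), of 2] one_le_power[OF y(1)] by simp_all
    \<comment> \<open>Zeros of modulus greater than \<open>9 x\<close> lie outside every disc that occurs below.\<close>
    define Z where "Z = {w. F w = 0 \<and> norm w \<le> 9 * x}"
    have finZ: "finite Z" unfolding Z_def by (rule finite_zeros_entire[OF F(1) ex])
    have mult1: "1 \<le> real (nat (zorder F w))" if "w \<in> Z" for w
      using zorder_entire(2)[OF F(1) ex, of w] that by (simp add: Z_def)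
    have count: "(\<Sum>w\<in>Z. real (nat (zorder F w))) \<le> c * y"
      using C1(2)[of "9 * x"] x2 by (simp add: Z_def c_def y_def power_mult_distrib mult_ac)
    define P where "P = norm ` Z"
    have finP: "finite P" using finZ by (simp add: P_def)
    have "real (card P) \<le> real (card Z)" unfolding P_def using finZ by (simp add: card_image_le)
    also have "\<dots> \<le> (\<Sum>w\<in>Z. real (nat (zorder F w)))"
      using sum_mono[of Z "\<lambda>_. 1 :: real", OF mult1] by simp
    finally have cardP: "real (card P) \<le> c * y" using count by simp
    obtain r where r: "r \<in> {x..x+1}" "\<And>p. p \<in> P \<Longrightarrow> \<bar>p - r\<bar> \<ge> 1 / (2 * (real (card P) + 1))"
      using avoid_finite_set_by_gap[OF finP] by metis
    \<comment> \<open>Half the guaranteed distance from the circle to the zeros, so that the annulus of this width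
      also keeps the distance \<open>\<epsilon>\<close>.\<close>
    define \<epsilon> where "\<epsilon> = 1 / (4 * (real (card P) + 1))"
    have \<epsilon>: "\<epsilon> > 0" "\<epsilon> \<le> 1" "2 * \<epsilon> = 1 / (2 * (real (card P) + 1))"
      by (simp_all add: \<epsilon>_def field_simps)
    have inv: "1 / \<epsilon> \<le> 4 * (c + 1) * y"
    proof -
      have "1 / \<epsilon> = 4 * real (card P) + 4" by (simp add: \<epsilon>_def)
      also have "\<dots> \<le> 4 * (c * y) + 4 * y" using cardP y by simp
      finally show ?thesis by (simp add: algebra_simps)
    qed
    also have "\<dots> \<le> C * y\<^sup>2" using C yy y c0 by (intro mult_mono) auto
    finally have inv2: "1 / \<epsilon> \<le> C * y\<^sup>2" .
    obtain \<rho> where \<rho>: "8 * x \<le> \<rho>" "\<rho> \<le> 8 * x + 1" "\<And>z. norm z = \<rho> \<Longrightarrow> F z \<noteq> 0"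
      using zero_free_circle[OF F(1) ex] by metis
    have "F z \<noteq> 0 \<and> norm (deriv F z / F z) \<le> C * y\<^sup>2" if z: "\<bar>norm z - r\<bar> \<le> \<epsilon>" for z
    proof -
      have zx: "norm z \<le> 2 * x" using z r(1) \<epsilon>(1,2) x2(1) by (simp add: abs_le_iff)
      have dist: "\<epsilon> \<le> norm (z - w)" if "w \<in> Z" for w
      proof -
        have "norm w \<in> P" using that by (simp add: P_def)
        then have "2 * \<epsilon> \<le> \<bar>norm w - r\<bar>" using r(2) \<epsilon>(3) by simp
        moreover have "\<bar>norm z - norm w\<bar> \<le> norm (z - w)" by (rule norm_triangle_ineq3)
        ultimately show ?thesis using z by linarith
      qed
      have Fz: "F z \<noteq> 0"
        using dist[of z] \<epsilon>(1) zx x2 by (auto simp: Z_def)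
      have sub: "{w. F w = 0 \<and> norm w < \<rho>} \<subseteq> Z" using \<rho>(2) x2 by (auto simp: Z_def)
      have "norm (deriv F z / F z) \<le>
         (\<Sum>w | F w = 0 \<and> norm w < \<rho>. real (nat (zorder F w))) * (1 / \<epsilon> + 2 / \<rho>) +
         4 * (4 * nevanlinna_T F \<rho> - 2 * ln (norm (F 0))) / \<rho>"
      proof (rule log_derivative_bound[OF F _ _ _ Fz \<epsilon>(1)])
        show "\<epsilon> \<le> norm (z - w)" if "F w = 0" "norm w < \<rho>" for w
          using that sub dist by blast
      qed (use \<rho> x2 zx in auto)
      also have "\<dots> \<le> c * y * (4 * (c + 1) * y + 2 * y) + 4 * (4 * (9 ^ K * y) + 2 * (L * y))"
      proof (rule add_mono)
        have "(\<Sum>w | F w = 0 \<and> norm w < \<rho>. real (nat (zorder F w))) \<le> c * y"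
          using sum_mono2[OF finZ sub, of "\<lambda>w. real (nat (zorder F w))"] count by simp
        moreover have "2 / \<rho> \<le> 2 * y" 
        proof -
          have "2 / \<rho> \<le> 2 / 1" using \<rho> x2 by (intro divide_left_mono) auto
          then show ?thesis using y(1) by simp
        qed
        ultimately show "(\<Sum>w | F w = 0 \<and> norm w < \<rho>. real (nat (zorder F w))) * (1 / \<epsilon> + 2 / \<rho>)
          \<le> c * y * (4 * (c + 1) * y + 2 * y)"
          using inv c0 y \<epsilon> \<rho> x2 by (intro mult_mono add_mono) auto
        have "nevanlinna_T F \<rho> \<le> \<rho> ^ K" using T \<rho> x2 by simp
        also have "\<dots> \<le> (9 * x) ^ K" using \<rho> x2 by (intro power_mono) auto
        also have "\<dots> = 9 ^ K * y" by (simp add: power_mult_distrib y_def)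
        finally have 1: "nevanlinna_T F \<rho> \<le> 9 ^ K * y" .
        have 2: "- ln (norm (F 0)) \<le> L * y"
          using mult_left_mono[OF y(1) c0(2)] by (simp add: L_def)
        define B where "B = 4 * (4 * (9 ^ K * y) + 2 * (L * y))"
        have B: "4 * (4 * nevanlinna_T F \<rho> - 2 * ln (norm (F 0))) \<le> B" using 1 2 by (simp add: B_def)
        have "B \<ge> 0" using c0 y by (simp add: B_def)
        have "4 * (4 * nevanlinna_T F \<rho> - 2 * ln (norm (F 0))) / \<rho> \<le> B / \<rho>"
          using B \<rho> x2 by (intro divide_right_mono) auto
        also have "\<dots> \<le> B / 1" using \<rho> x2 \<open>B \<ge> 0\<close> by (intro divide_left_mono) auto
        finally show "4 * (4 * nevanlinna_T F \<rho> - 2 * ln (norm (F 0))) / \<rho> \<le>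
          4 * (4 * (9 ^ K * y) + 2 * (L * y))" by (simp add: B_def)
      qed
      also have "\<dots> = c * (4 * (c + 1) + 2) * y\<^sup>2 + 4 * (4 * 9 ^ K + 2 * L) * y"
        by (simp add: power2_eq_square algebra_simps)
      also have "\<dots> \<le> c * (4 * (c + 1) + 2) * y\<^sup>2 + 4 * (4 * 9 ^ K + 2 * L) * y\<^sup>2"
        using yy c0 by (intro add_left_mono mult_left_mono) auto
      also have "\<dots> = (C - 4 * (c + 1)) * y\<^sup>2" by (simp add: C_def algebra_simps)
      also have "\<dots> \<le> C * y\<^sup>2" using c0 by (intro mult_right_mono) auto
      finally show ?thesis using Fz by blast
    qed
    then show ?thesis using r(1) \<epsilon> inv2 unfolding y(2) by blast
  qed
  moreover have "x0 \<ge> 1" by (simp add: x0_def)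
  ultimately show ?thesis using C(2) by blast
qed

text \<open>
  With \<open>q = f'/f\<close> one has \<open>f''/f = q' + q\<^sup>2\<close>, and \<open>q'\<close> is bounded by Cauchy's estimate.
\<close>

lemma second_log_derivative:
  assumes f: "f holomorphic_on UNIV" and \<epsilon>: "\<epsilon> > 0"
    and nz: "\<And>u. norm (u - z) \<le> \<epsilon> \<Longrightarrow> f u \<noteq> 0"
    and Q: "\<And>u. norm (u - z) \<le> \<epsilon> \<Longrightarrow> norm (deriv f u / f u) \<le> Q"
  shows "norm (deriv (deriv f) z / f z) \<le> Q / \<epsilon> + Q\<^sup>2"
proof -
  define q where "q u = deriv f u / f u" for u
  have df: "deriv f holomorphic_on UNIV" by (rule holomorphic_deriv[OF f open_UNIV])
  have qhol: "q holomorphic_on cball z \<epsilon>"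
    unfolding q_def using nz
    by (intro holomorphic_intros holomorphic_on_subset[OF f] holomorphic_on_subset[OF df])
       (auto simp: dist_norm norm_minus_commute)
  then have qhol': "q holomorphic_on ball z \<epsilon>" by (rule holomorphic_on_subset) auto
  have "norm ((deriv ^^ 1) q z) \<le> fact 1 * Q / \<epsilon> ^ 1"
  proof (rule Cauchy_inequality[OF qhol'])
    show "continuous_on (cball z \<epsilon>) q" by (rule holomorphic_on_imp_continuous_on[OF qhol])
    show "norm (q u) \<le> Q" if "norm (z - u) = \<epsilon>" for u
      using Q[of u] that by (simp add: q_def norm_minus_commute)
  qed (use \<epsilon> in auto)
  then have dq: "norm (deriv q z) \<le> Q / \<epsilon>" by simp
  have "(q has_field_derivative deriv q z) (at z)"
    by (rule holomorphic_derivI[OF qhol']) (use \<epsilon> in auto)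
  moreover have "(f has_field_derivative deriv f z) (at z)"
    by (rule holomorphic_derivI[OF f]) auto
  ultimately have "((\<lambda>u. q u * f u) has_field_derivative deriv q z * f z + deriv f z * q z) (at z)"
    by (rule DERIV_mult)
  then have "(deriv f has_field_derivative deriv q z * f z + deriv f z * q z) (at z)"
    by (rule has_field_derivative_transform_within_open[of _ _ _ "ball z \<epsilon>"])
       (use nz \<epsilon> in \<open>auto simp: q_def dist_norm norm_minus_commute\<close>)
  then have "deriv (deriv f) z = deriv q z * f z + deriv f z * q z" by (rule DERIV_imp_deriv)
  moreover have "f z \<noteq> 0" using nz[of z] \<epsilon> by simp
  ultimately have "deriv (deriv f) z / f z = deriv q z + (q z)\<^sup>2"
    by (simp add: q_def field_simps power2_eq_square)
  also have "norm \<dots> \<le> norm (deriv q z) + norm (q z) ^ 2"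
    using norm_triangle_ineq[of "deriv q z" "(q z)\<^sup>2"] by (simp add: norm_power)
  also have "\<dots> \<le> Q / \<epsilon> + Q\<^sup>2"
    using dq Q[of z] \<epsilon> by (intro add_mono power_mono) (auto simp: q_def)
  finally show ?thesis .
qed

lemma growth_order_less_imp_eventually:
  assumes "growth_order f < ereal s"
  shows "\<exists>r0\<ge>1. \<forall>r\<ge>r0. nevanlinna_T f r \<le> r powr s"
proof -
  have "eventually (\<lambda>r. ereal (log_plus (nevanlinna_T f r) / ln r) < ereal s) at_top"
    using assms unfolding growth_order_def by (rule Limsup_lessD)
  then obtain a where a: "\<And>r. r \<ge> a \<Longrightarrow> log_plus (nevanlinna_T f r) / ln r < s"
    by (auto simp: eventually_at_top_linorder)
  have "nevanlinna_T f r \<le> r powr s" if "r \<ge> max 2 a" for r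
  proof (cases "nevanlinna_T f r > 0")
    case True
    have r: "r \<ge> 2" "ln r > 0" using that by auto
    have "ln (nevanlinna_T f r) \<le> log_plus (nevanlinna_T f r)" by (simp add: log_plus_def)
    also have "\<dots> \<le> s * ln r" using a[of r] that r by (simp add: field_simps)
    finally have "exp (ln (nevanlinna_T f r)) \<le> exp (s * ln r)" by simp
    then show ?thesis using True r by (simp add: powr_def)
  next
    case False
    then show ?thesis using powr_ge_zero[of r s] by linarith
  qed
  then show ?thesis by (intro exI[of _ "max 2 a"]) auto
qed

lemma growth_order_finite_imp_power_bound:
  assumes "growth_order f \<noteq> \<infinity>"
  shows "\<exists>K r0. \<forall>r\<ge>r0. nevanlinna_T f r \<le> r ^ K"
proof -
  obtain K :: nat where K: "growth_order f < ereal (real K)"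
    using assms less_PInf_Ex_of_nat[of "growth_order f"] by (auto simp: top.not_eq_extremum)
  then obtain r0 where r0: "r0 \<ge> 1" "\<And>r. r \<ge> r0 \<Longrightarrow> nevanlinna_T f r \<le> r powr real K"
    using growth_order_less_imp_eventually by blast
  have "nevanlinna_T f r \<le> r ^ K" if "r \<ge> r0" for r
    using r0(1) r0(2)[OF that] that by (simp add: powr_realpow)
  then show ?thesis by blast
qed

text \<open>
  Jensen's formula requires \<open>F 0 \<noteq> 0\<close>. Dividing by \<open>z^m\<close> does not increase the characteristic for
  \<open>r \<ge> 1\<close>.
\<close>

lemma split_off_zero_at_origin:
  assumes f: "f holomorphic_on UNIV" "\<exists>z. f z \<noteq> 0"
  obtains F m where "F holomorphic_on UNIV" "F 0 \<noteq> 0" "\<And>z. f z = F z * z ^ m"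
    "\<And>r. r \<ge> 1 \<Longrightarrow> nevanlinna_T F r \<le> nevanlinna_T f r"
proof -
  obtain F where F: "F holomorphic_on UNIV" "\<And>z. f z = F z * (z - 0) ^ nat (zorder f 0)" "F 0 \<noteq> 0"
    using divide_zero_entire[OF f] by metis
  have "nevanlinna_T F r \<le> nevanlinna_T f r" if r: "r \<ge> 1" for r
  proof -
    have "circle_mean (\<lambda>z. log_plus (norm (F z))) r \<le> circle_mean (\<lambda>z. log_plus (norm (f z))) r"
    proof (intro circle_mean_mono continuous_on_log_plus_norm continuous_on_entire F f log_plus_mono)
      fix z :: complex assume "norm z = r"
      then have "1 \<le> norm z ^ nat (zorder f 0)" using r by simp
      then show "norm (F z) \<le> norm (f z)"
        using mult_left_mono[of 1 "norm z ^ nat (zorder f 0)" "norm (F z)"]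
        by (simp add: F(2)[of z] norm_mult norm_power)
    qed (use r in auto)
    then show ?thesis
      using r nevanlinna_T_eq_circle_mean[OF continuous_on_entire[OF F(1)], of r]
        nevanlinna_T_eq_circle_mean[OF continuous_on_entire[OF f(1)], of r] by simp
  qed
  then show ?thesis using that[OF F(1,3), of "nat (zorder f 0)"] F(2) by simp
qed

lemma log_derivatives_polynomial_on_circles:
  assumes f: "f holomorphic_on UNIV" "\<exists>z. f z \<noteq> 0"
    and T: "\<And>r. r \<ge> r0 \<Longrightarrow> nevanlinna_T f r \<le> r ^ K"
  shows "\<exists>L x0. x0 \<ge> 1 \<and> (\<forall>x\<ge>x0. \<exists>r\<in>{x..x+1}. \<forall>z. norm z = r \<longrightarrow>
    f z \<noteq> 0 \<and> norm (deriv f z / f z) \<le> x ^ L \<and> norm (deriv (deriv f) z / f z) \<le> x ^ L)"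
proof -
  obtain F m where F: "F holomorphic_on UNIV" "F 0 \<noteq> 0" "\<And>z. f z = F z * z ^ m"
    "\<And>r. r \<ge> 1 \<Longrightarrow> nevanlinna_T F r \<le> nevanlinna_T f r"
    using split_off_zero_at_origin[OF f] by metis
  have "nevanlinna_T F r \<le> r ^ K" if "r \<ge> max 1 r0" for r
    using F(4)[of r] T[of r] that by simp
  from log_derivative_polynomial_near_circles[of F "max 1 r0" K, OF F(1,2) this]
  obtain C x0 where C: "C \<ge> 1" "x0 \<ge> 1" and near: "\<forall>x\<ge>x0.
    \<exists>r\<in>{x..x+1}. \<exists>\<epsilon>>0. \<epsilon> \<le> 1 \<and> 1 / \<epsilon> \<le> C * x ^ (2 * K) \<and>
       (\<forall>z. \<bar>norm z - r\<bar> \<le> \<epsilon> \<longrightarrow> F z \<noteq> 0 \<and> norm (deriv F z / F z) \<le> C * x ^ (2 * K))"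
    by blast
  define c where "c = C + real m"
  define x1 where "x1 = max (max x0 2) (2 * c\<^sup>2)"
  have c: "c \<ge> 1" "C \<le> c" using C by (auto simp: c_def)
  have "\<exists>r\<in>{x..x+1}. \<forall>z. norm z = r \<longrightarrow> f z \<noteq> 0 \<and>
      norm (deriv f z / f z) \<le> x ^ (4 * K + 1) \<and> norm (deriv (deriv f) z / f z) \<le> x ^ (4 * K + 1)"
    if x: "x \<ge> x1" for x
  proof -
    have x': "x \<ge> x0" "x \<ge> 2" "x \<ge> 2 * c\<^sup>2" using x by (auto simp: x1_def)
    obtain r \<epsilon> where r: "r \<in> {x..x+1}" and \<epsilon>: "\<epsilon> > 0" "\<epsilon> \<le> 1" "1 / \<epsilon> \<le> C * x ^ (2 * K)"
      and ann: "\<And>z. \<bar>norm z - r\<bar> \<le> \<epsilon> \<Longrightarrow> F z \<noteq> 0 \<and> norm (deriv F z / F z) \<le> C * x ^ (2 * K)"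
      using near x'(1) by blast
    define y where "y = x ^ (2 * K)"
    have y: "y \<ge> 1" using x' by (simp add: y_def)
    define Q where "Q = c * y"
    have Q: "Q \<ge> 1" using c(1) y mult_mono[OF c(1) y] by (simp add: Q_def)
    have Q2: "2 * Q\<^sup>2 \<le> x ^ (4 * K + 1)"
    proof -
      have "2 * Q\<^sup>2 = (2 * c\<^sup>2) * x ^ (4 * K)"
        by (simp add: Q_def y_def power_mult_distrib flip: power_mult)
      also have "\<dots> \<le> x * x ^ (4 * K)" using x' by (intro mult_right_mono) auto
      finally show ?thesis by simp
    qed
    have fz: "f u \<noteq> 0 \<and> norm (deriv f u / f u) \<le> Q" if u: "\<bar>norm u - r\<bar> \<le> \<epsilon>" for u
    proof -
      have u1: "norm u \<ge> 1" using u r \<epsilon> x' by (simp add: abs_le_iff)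
      then have u0: "u \<noteq> 0" by auto
      have Fu: "F u \<noteq> 0" using ann[OF u] by blast
      have "(F has_field_derivative deriv F u) (at u)"
        by (rule holomorphic_derivI[OF F(1)]) auto
      then have "((\<lambda>z. F z * z ^ m) has_field_derivative
          deriv F u * u ^ m + F u * (of_nat m * u ^ (m - 1))) (at u)"
        by (auto intro!: derivative_eq_intros)
      moreover have "f = (\<lambda>z. F z * z ^ m)" using F(3) by auto
      ultimately have "deriv f u = deriv F u * u ^ m + F u * (of_nat m * u ^ (m - 1))"
        by (simp add: DERIV_imp_deriv)
      then have "deriv f u / f u = deriv F u / F u + of_nat m / u"
        using u0 Fu by (cases m) (auto simp: F(3)[of u] field_simps)
      also have "norm \<dots> \<le> C * y + real m"
      proof (rule order.trans[OF norm_triangle_ineq add_mono])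
        show "norm (deriv F u / F u) \<le> C * y" using ann[OF u] by (simp add: y_def)
        have "real m / norm u \<le> real m / 1" using u1 by (intro divide_left_mono) auto
        then show "norm (of_nat m / u) \<le> real m" by (simp add: norm_divide)
      qed
      also have "\<dots> \<le> Q" using y mult_left_mono[OF y, of "real m"] by (simp add: Q_def c_def distrib_right)
      finally show ?thesis using u0 Fu by (simp add: F(3)[of u])
    qed
    have "f z \<noteq> 0 \<and> norm (deriv f z / f z) \<le> x ^ (4 * K + 1) \<and>
        norm (deriv (deriv f) z / f z) \<le> x ^ (4 * K + 1)" if z: "norm z = r" for z
    proof (intro conjI)
      show "f z \<noteq> 0" using fz[of z] z \<epsilon> by simp
      have QQ: "Q \<le> Q\<^sup>2" using self_le_power[OF Q, of 2] by simp
      show "norm (deriv f z / f z) \<le> x ^ (4 * K + 1)" 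
        using fz[of z] z \<epsilon>(1) QQ Q2 Q by simp
      have near_z: "\<bar>norm u - r\<bar> \<le> \<epsilon>" if "norm (u - z) \<le> \<epsilon>" for u
        using norm_triangle_ineq3[of u z] that z by simp
      have "norm (deriv (deriv f) z / f z) \<le> Q / \<epsilon> + Q\<^sup>2"
        by (rule second_log_derivative[OF f(1) \<epsilon>(1)]) (use fz near_z in blast)+
      also have "Q / \<epsilon> \<le> Q * Q"
      proof -
        have "1 / \<epsilon> \<le> C * y" using \<epsilon>(3) by (simp add: y_def)
        also have "\<dots> \<le> Q" unfolding Q_def using c y by (intro mult_right_mono) auto
        finally show ?thesis using mult_left_mono[of "1 / \<epsilon>" Q Q] Q by simp
      qed
      also have "Q * Q + Q\<^sup>2 = 2 * Q\<^sup>2" by (simp add: power2_eq_square)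
      finally show "norm (deriv (deriv f) z / f z) \<le> x ^ (4 * K + 1)" using Q2 by simp
    qed
    then show ?thesis using r by blast
  qed
  moreover have "x1 \<ge> 1" by (simp add: x1_def)
  ultimately show ?thesis by blast
qed

section \<open>Entire functions with few zeros\<close>

text \<open>
  Near 0 the factor is \<open>1 + O(u^(p + 1))\<close> with \<open>s \<le> p + 1\<close>; away from 0 the logarithm of its modulus
  is at most the sum of \<open>ln (1 + |u|)\<close> and the powers \<open>|u|^k\<close> with \<open>k \<le> p \<le> s\<close>.
\<close>

lemma weierstrass_factor_growth:
  fixes s :: real
  assumes s: "real p \<le> s" "s \<le> real p + 1" "s > 0"
  shows "\<exists>C\<ge>0. \<forall>u. norm (weierstrass_factor p u) \<le> exp (C * norm u powr s)"
proof -
  define C where "C = 3 + 2 * 2 powr s + 1 / s + real p * 2 powr s"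
  have C: "C \<ge> 3" "C \<ge> 2 * 2 powr s + 1 / s + real p * 2 powr s" using s by (auto simp: C_def)
  have "norm (weierstrass_factor p u) \<le> exp (C * norm u powr s)" for u
  proof (cases "norm u \<le> 1 / 2")
    case True
    have "norm (weierstrass_factor p u) \<le> 1 + norm (weierstrass_factor p u - 1)"
      using norm_triangle_ineq[of 1 "weierstrass_factor p u - 1"] by simp
    also have "\<dots> \<le> 1 + 3 * norm u ^ Suc p" using weierstrass_factor_bound[OF True] by simp
    also have "\<dots> \<le> exp (3 * norm u ^ Suc p)" by (rule exp_ge_add_one_self)
    also have "norm u ^ Suc p \<le> norm u powr s"
    proof (cases "u = 0")
      case False
      have "norm u ^ Suc p = norm u powr real (Suc p)" using False by (simp only: powr_realpow zero_less_norm_iff not_False_eq_True)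
      also have "\<dots> \<le> norm u powr s" using True False s by (intro powr_mono') auto
      finally show ?thesis .
    qed auto
    also have "3 * norm u powr s \<le> C * norm u powr s" using C by (intro mult_right_mono) auto
    finally show ?thesis by simp
  next
    case False
    define t where "t = norm u"
    have t: "t > 1 / 2" using False by (simp add: t_def)
    have pk: "t ^ k \<le> 2 powr s * t powr s" if "real k \<le> s" for k
    proof -
      have "t ^ k \<le> (2 * t) ^ k" using t by (intro power_mono) auto
      also have "\<dots> = (2 * t) powr real k" using t by (simp add: powr_realpow)
      also have "\<dots> \<le> (2 * t) powr s" using t that by (intro powr_mono) auto
      also have "\<dots> = 2 powr s * t powr s" using t by (simp add: powr_mult)
      finally show ?thesis .
    qed
    have "ln t \<le> t powr s / s"
    proof (cases "t \<ge> 1")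
      case True
      then show ?thesis using s by (intro ln_powr_bound) auto
    next
      case False
      then have "ln t \<le> 0" using t by simp
      also have "0 \<le> t powr s / s" using s by simp
      finally show ?thesis .
    qed
    moreover have "ln (3::real) \<le> 2 * 1" using ln_le_minus_one[of 3] by simp
    moreover have "(1::real) \<le> 2 powr s * t powr s" using pk[of 0] s by simp
    ultimately have l: "ln (3 * t) \<le> (2 * 2 powr s + 1 / s) * t powr s"
      using t by (simp add: ln_mult_pos algebra_simps)
    have "norm (1 - u) \<le> 1 + t" using norm_triangle_ineq4[of 1 u] by (simp add: t_def)
    also have "\<dots> \<le> exp (ln (3 * t))" using t by simp
    also have "\<dots> \<le> exp ((2 * 2 powr s + 1 / s) * t powr s)" using l by simp
    finally have 1: "norm (1 - u) \<le> exp ((2 * 2 powr s + 1 / s) * t powr s)" .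
    have "norm (\<Sum>k=1..p. u ^ k / of_nat k) \<le> (\<Sum>k=1..p. 2 powr s * t powr s)"
    proof (rule sum_norm_le)
      fix k assume k: "k \<in> {1..p}"
      have "norm (u ^ k / of_nat k) = t ^ k / real k" by (simp add: norm_divide norm_power t_def)
      also have "\<dots> \<le> t ^ k / 1" using k t by (intro divide_left_mono) auto
      also have "\<dots> \<le> 2 powr s * t powr s" using pk[of k] k s by simp
      finally show "norm (u ^ k / of_nat k) \<le> 2 powr s * t powr s" .
    qed
    then have "norm (exp (\<Sum>k=1..p. u ^ k / of_nat k)) \<le> exp (real p * 2 powr s * t powr s)"
      by (intro order.trans[OF norm_exp]) (simp add: mult.assoc)
    with 1 have "norm (weierstrass_factor p u) \<le>
        exp ((2 * 2 powr s + 1 / s) * t powr s) * exp (real p * 2 powr s * t powr s)"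
      unfolding weierstrass_factor_def norm_mult by (intro mult_mono) auto
    also have "\<dots> = exp ((2 * 2 powr s + 1 / s + real p * 2 powr s) * t powr s)"
      by (simp add: exp_add [symmetric] algebra_simps)
    also have "\<dots> \<le> exp (C * t powr s)" unfolding exp_le_cancel_iff using C by (intro mult_right_mono) auto
    finally show ?thesis by (simp add: t_def)
  qed
  then show ?thesis using C by (intro exI[of _ C]) auto
qed

text \<open>
  Only the zeros in a disc enter, so the product is finite; all estimates for it are uniform in \<open>R\<close>,
  and \<open>R\<close> tends to infinity at the end.
\<close>

definition canonical_product :: "nat \<Rightarrow> (complex \<Rightarrow> complex) \<Rightarrow> real \<Rightarrow> complex \<Rightarrow> complex" where
  "canonical_product p F R z =
     (\<Prod>w | F w = 0 \<and> norm w < R. weierstrass_factor p (z / w) ^ nat (zorder F w))"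

lemma canonical_factorization:
  assumes F: "F holomorphic_on UNIV" "F 0 \<noteq> 0" and R: "R > 0"
  obtains h where "h holomorphic_on ball 0 R"
    "\<And>z. norm z < R \<Longrightarrow> F z = canonical_product p F R z * exp (h z)"
proof -
  define Z where "Z = {w. F w = 0 \<and> norm w < R}"
  define m where "m w = nat (zorder F w)" for w
  have ex: "\<exists>z. F z \<noteq> 0" using F by blast
  have finZ: "finite Z"
    by (rule finite_subset[OF _ finite_zeros_entire[OF F(1) ex, of R]]) (auto simp: Z_def)
  have Z0: "w \<noteq> 0" if "w \<in> Z" for w using that F(2) by (auto simp: Z_def)
  obtain G where G: "G holomorphic_on UNIV"
    "\<And>z. F z = G z * (\<Prod>w\<in>Z. (z - w) ^ m w)" "\<And>w. w \<in> Z \<Longrightarrow> G w \<noteq> 0"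
    using divide_finite_zeros_entire[OF F(1) ex finZ] unfolding m_def by metis
  define e where "e w z = - w * exp (- (\<Sum>k=1..p. (z / w) ^ k / of_nat k))" for w z :: complex
  define g where "g z = G z * (\<Prod>w\<in>Z. e w z ^ m w)" for z
  have ghol: "g holomorphic_on ball 0 R"
    unfolding g_def e_def using Z0 by (intro holomorphic_intros holomorphic_on_subset[OF G(1)]) auto
  have gnz: "g z \<noteq> 0" if "norm z < R" for z
  proof -
    have "G z \<noteq> 0" using G(2,3)[of z] that by (cases "z \<in> Z") (auto simp: Z_def)
    then show ?thesis using Z0 finZ by (auto simp: g_def e_def)
  qed
  have "\<exists>h. h holomorphic_on ball 0 R \<and> (\<forall>z\<in>ball 0 R. exp (h z) = g z)"
    by (rule holomorphic_logarithm_exists[OF convex_ball open_ball ghol, of 0]) (use gnz R in auto)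
  then obtain h where h: "h holomorphic_on ball 0 R" "\<And>z. z \<in> ball 0 R \<Longrightarrow> exp (h z) = g z"
    by blast
  have "F z = canonical_product p F R z * exp (h z)" if "norm z < R" for z
  proof -
    have 1: "exp (h z) = g z" using h(2) that by simp
    have 2: "(\<Prod>w\<in>Z. (z - w) ^ m w) =
      (\<Prod>w\<in>Z. weierstrass_factor p (z / w) ^ m w) * (\<Prod>w\<in>Z. e w z ^ m w)"
      unfolding prod.distrib [symmetric] power_mult_distrib [symmetric]
    proof (intro prod.cong refl arg_cong2[of _ _ _ _ "(^)"])
      fix w assume "w \<in> Z"
      then have "w \<noteq> 0" by (rule Z0)
      then show "z - w = weierstrass_factor p (z / w) * e w z"
        by (simp add: weierstrass_factor_def e_def exp_minus field_simps)
    qed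
    show ?thesis
      unfolding 1 g_def G(2)[of z] 2 canonical_product_def Z_def [symmetric] m_def [symmetric] by (simp add: mult_ac)
  qed
  with h(1) that show ?thesis by blast
qed

lemma canonical_product_growth:
  assumes F: "F holomorphic_on UNIV" "F 0 \<noteq> 0"
    and C: "C \<ge> 0" "\<And>u. norm (weierstrass_factor p u) \<le> exp (C * norm u powr s)"
    and S: "\<And>Z. finite Z \<Longrightarrow> Z \<subseteq> {w. F w = 0} \<Longrightarrow> (\<Sum>w\<in>Z. real (nat (zorder F w)) * norm w powr (- s)) \<le> S"
  shows "norm (canonical_product p F R z) \<le> exp (C * S * norm z powr s)"
proof -
  define Z where "Z = {w. F w = 0 \<and> norm w < R}"
  define m where "m w = nat (zorder F w)" for w
  have ex: "\<exists>z. F z \<noteq> 0" using F by blast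
  have finZ: "finite Z"
    by (rule finite_subset[OF _ finite_zeros_entire[OF F(1) ex, of R]]) (auto simp: Z_def)
  have "norm (canonical_product p F R z) = (\<Prod>w\<in>Z. norm (weierstrass_factor p (z / w)) ^ m w)"
    by (simp add: canonical_product_def Z_def m_def norm_power flip: prod_norm)
  also have "\<dots> \<le> (\<Prod>w\<in>Z. exp (C * norm (z / w) powr s) ^ m w)"
    by (intro prod_mono conjI power_mono C(2)) auto
  also have "\<dots> = exp (\<Sum>w\<in>Z. real (m w) * (C * norm (z / w) powr s))"
    using finZ by (simp add: exp_sum exp_of_nat_mult)
  also have "(\<Sum>w\<in>Z. real (m w) * (C * norm (z / w) powr s)) =
      C * (\<Sum>w\<in>Z. real (m w) * norm w powr (- s)) * norm z powr s"
    by (simp add: sum_distrib_left sum_distrib_right norm_divide powr_divide powr_minus_divide mult_ac)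
  also have "\<dots> \<le> C * S * norm z powr s"
    using S[OF finZ] C(1) unfolding m_def by (intro mult_right_mono mult_left_mono) (auto simp: Z_def)
  finally show ?thesis by simp
qed

text \<open>
  On the circle \<open>Re h = ln |F| - ln |v|\<close>, where \<open>v\<close> is the canonical product. The positive part of
  \<open>- ln |v|\<close> differs from \<open>- ln |v|\<close> by at most the upper bound \<open>C \<rho>^s\<close> for \<open>ln |v|\<close>, and the mean of
  \<open>- ln |v|\<close> is at most \<open>- ln |v 0| = 0\<close> by Jensen's inequality.
\<close>

lemma canonical_quotient_coefficients:
  assumes F: "F holomorphic_on UNIV" "F 0 \<noteq> 0" and \<rho>: "0 < \<rho>" "\<rho> < R"
    and h: "h holomorphic_on ball 0 R"
    and fac: "\<And>z. norm z < R \<Longrightarrow> F z = canonical_product p F R z * exp (h z)"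
    and growth: "\<And>z. norm (canonical_product p F R z) \<le> exp (C * norm z powr s)" and C: "C \<ge> 0"
    and sph: "\<And>z. norm z = \<rho> \<Longrightarrow> F z \<noteq> 0" and j: "j > 0"
  shows "norm ((deriv ^^ j) h 0 / fact j) * \<rho> ^ j \<le>
    4 * (nevanlinna_T F \<rho> + C * \<rho> powr s) - 2 * ln (norm (F 0))"
proof -
  define v where "v = canonical_product p F R"
  have v0: "v 0 = 1" by (simp add: v_def canonical_product_def)
  have "v holomorphic_on UNIV"
    unfolding v_def canonical_product_def [abs_def]
    by (intro holomorphic_on_prod holomorphic_on_power weierstrass_factor_holomorphic holomorphic_intros)
       (use F(2) in auto)
  note contv = continuous_on_entire[OF this]
  have vnz: "v z \<noteq> 0" if "norm z = \<rho>" for z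
    using sph[OF that] fac[of z] that \<rho> by (auto simp: v_def)
  have h0: "Re (h 0) = ln (norm (F 0))"
    using fac[of 0] \<rho> v0 by (simp add: v_def)
  have conth: "continuous_on (sphere 0 \<rho>) h"
    by (rule continuous_on_subset[OF holomorphic_on_imp_continuous_on[OF h]]) (use \<rho> in auto)
  have contlnv: "continuous_on (sphere 0 \<rho>) (\<lambda>z. ln (norm (v z)))"
    using vnz by (intro continuous_intros contv) auto
  have "circle_mean (\<lambda>z. max 0 (Re (h z))) \<rho> \<le>
      circle_mean (\<lambda>z. (log_plus (norm (F z)) + C * \<rho> powr s) - ln (norm (v z))) \<rho>"
  proof (rule circle_mean_mono)
    fix z :: complex assume z: "norm z = \<rho>"
    have "norm (F z) = norm (v z) * exp (Re (h z))"
      using fac[of z] z \<rho> by (simp add: v_def norm_mult)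
    then have "Re (h z) = ln (norm (F z)) - ln (norm (v z))"
      using vnz[OF z] by (simp add: ln_mult)
    moreover have "ln (norm (v z)) \<le> ln (exp (C * \<rho> powr s))"
      using growth[of z] vnz[OF z] z by (subst ln_le_cancel_iff) (auto simp: v_def)
    moreover have "0 \<le> C * \<rho> powr s" using C by simp
    ultimately show "max 0 (Re (h z)) \<le> (log_plus (norm (F z)) + C * \<rho> powr s) - ln (norm (v z))"
      using log_plus_nonneg[of "norm (F z)"] ln_le_log_plus[of "norm (F z)"]
      by (simp only: max.bounded_iff ln_exp) linarith
  qed (use \<rho> in \<open>auto intro!: continuous_intros conth contlnv continuous_on_log_plus_norm continuous_on_entire[OF F(1)]\<close>)
  also have "\<dots> = nevanlinna_T F \<rho> + C * \<rho> powr s - circle_mean (\<lambda>z. ln (norm (v z))) \<rho>"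
    using \<rho> nevanlinna_T_eq_circle_mean[OF continuous_on_entire[OF F(1)] \<rho>(1)]
    by (simp add: circle_mean_diff circle_mean_add contlnv continuous_on_add continuous_on_log_plus_norm
          continuous_on_entire[OF F(1)])
  also have "\<dots> \<le> nevanlinna_T F \<rho> + C * \<rho> powr s"
    using jensen_inequality[OF \<open>v holomorphic_on UNIV\<close> _ \<rho>(1) vnz] v0 by simp
  finally have "circle_mean (\<lambda>z. max 0 (Re (h z))) \<rho> \<le> nevanlinna_T F \<rho> + C * \<rho> powr s" .
  then show ?thesis
    using taylor_coefficient_le_circle_mean[OF h \<rho> j] h0 by simp
qed

text \<open>
  This is Hadamard's theorem in the form of an estimate. For each \<open>i\<close> write \<open>F = v exp h\<close> on the disc of
  radius \<open>i + 1\<close>, with a canonical product \<open>v\<close>. The coefficients of \<open>h\<close> of degree less than \<open>n\<close> stay bounded as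
  \<open>i\<close> grows and contribute \<open>O(|z|^(n - 1))\<close>, which \<open>|z|^s\<close> absorbs. Those of degree \<open>n\<close> converge along a
  subsequence. Those of higher degree contribute \<open>O(i powr (- 1/2))\<close> for fixed \<open>z\<close>, because the
  characteristic of \<open>F\<close> grows only like \<open>r powr (n + 1/2)\<close>.
\<close>

lemma hadamard_bound:
  assumes F: "F holomorphic_on UNIV" "F 0 \<noteq> 0"
    and n: "n > 0" and s: "real n - 1 \<le> s" "s < real n" "s > 0"
    and S: "\<And>Z. finite Z \<Longrightarrow> Z \<subseteq> {w. F w = 0} \<Longrightarrow> (\<Sum>w\<in>Z. real (nat (zorder F w)) * norm w powr (- s)) \<le> S"
    and T: "\<And>r. r \<ge> r0 \<Longrightarrow> nevanlinna_T F r \<le> r powr (real n + 1 / 2)"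
  shows "\<exists>a C. C \<ge> 0 \<and> (\<forall>z. norm z \<ge> 1 \<longrightarrow> norm (F z) \<le> exp (C * norm z powr s + Re (a * z ^ n)))"
proof -
  have ex: "\<exists>z. F z \<noteq> 0" using F by blast
  define p where "p = n - 1"
  have p: "n = Suc p" "real p \<le> s" "s \<le> real p + 1" using n s by (auto simp: p_def)
  obtain C0 where C0: "C0 \<ge> 0" "\<And>u. norm (weierstrass_factor p u) \<le> exp (C0 * norm u powr s)"
    using weierstrass_factor_growth[OF p(2,3) s(3)] by blast
  have S0: "S \<ge> 0" using S[of "{}"] by simp
  define C where "C = C0 * S"
  have C: "C \<ge> 0" using C0 S0 by (simp add: C_def)
  have growth: "norm (canonical_product p F R z) \<le> exp (C * norm z powr s)" for R z
    unfolding C_def by (rule canonical_product_growth[OF F C0 S])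
  define L where "L = ln (norm (F 0))"
  have "\<forall>i. \<exists>h. h holomorphic_on ball 0 (real (Suc i)) \<and>
    (\<forall>z. norm z < real (Suc i) \<longrightarrow> F z = canonical_product p F (real (Suc i)) z * exp (h z))"
    using canonical_factorization[OF F, of "real (Suc i)" p for i] by (metis of_nat_0_less_iff zero_less_Suc)
  then obtain h where h: "\<And>i. h i holomorphic_on ball 0 (real (Suc i))"
    and fac: "\<And>i z. norm z < real (Suc i) \<Longrightarrow> F z = canonical_product p F (real (Suc i)) z * exp (h i z)"
    by metis
  define a where "a i j = (deriv ^^ j) (h i) 0 / fact j" for i j
  define D where "D \<rho> = 4 * (nevanlinna_T F \<rho> + C * \<rho> powr s) - 2 * L" for \<rho>
  have coef: "norm (a i j) * \<rho> ^ j \<le> D \<rho>"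
    if "0 < \<rho>" "\<rho> < real (Suc i)" "\<And>z. norm z = \<rho> \<Longrightarrow> F z \<noteq> 0" "j > 0" for i j \<rho>
    unfolding a_def D_def L_def
    by (rule canonical_quotient_coefficients[OF F that(1,2) h fac growth C that(3,4)])
  have h0: "Re (h i 0) = L" for i
  proof -
    have "F 0 = exp (h i 0)" using fac[of 0 i] by (simp add: canonical_product_def)
    then show ?thesis by (simp add: L_def)
  qed
  have Fh: "norm (F z) \<le> exp (C * norm z powr s + Re (h i z))" if "norm z < real (Suc i)" for z i
  proof -
    have "norm (F z) = norm (canonical_product p F (real (Suc i)) z) * exp (Re (h i z))"
      using fac[OF that] by (simp add: norm_mult)
    also have "\<dots> \<le> exp (C * norm z powr s) * exp (Re (h i z))"
      by (intro mult_right_mono growth) auto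
    finally show ?thesis by (simp add: exp_add)
  qed
  \<comment> \<open>One fixed radius bounds every coefficient independently of \<open>i\<close>; only coefficients of degree
    at most \<open>n\<close> are estimated in this way.\<close>
  obtain \<rho>1 where \<rho>1: "max 1 r0 \<le> \<rho>1" "\<rho>1 \<le> max 1 r0 + 1" "\<And>z. norm z = \<rho>1 \<Longrightarrow> F z \<noteq> 0"
    using zero_free_circle[OF F(1) ex] by metis
  obtain N :: nat where N: "\<rho>1 < real N" using reals_Archimedean2 by blast
  define M where "M = D \<rho>1"
  have aM: "norm (a i j) \<le> M" if "i \<ge> N" "j > 0" for i j
  proof -
    have "norm (a i j) * 1 \<le> norm (a i j) * \<rho>1 ^ j"
      using \<rho>1(1) by (intro mult_left_mono) auto
    also have "\<dots> \<le> M" unfolding M_def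
      by (rule coef) (use \<rho>1 N that in auto)
    finally show ?thesis by simp
  qed
  have M0: "M \<ge> 0" using order.trans[OF norm_ge_zero aM[of N 1]] by simp
  have "bounded (range (\<lambda>i. a (i + N) n))"
    unfolding bounded_iff using aM n by (intro exI[of _ M]) auto
  then obtain \<alpha> \<sigma> where \<sigma>: "strict_mono \<sigma>" and lim: "((\<lambda>i. a (i + N) n) \<circ> \<sigma>) \<longlonglongrightarrow> \<alpha>"
    using bounded_imp_convergent_subsequence by blast
  define b where "b k = a (\<sigma> k + N) n" for k
  have blim: "b \<longlonglongrightarrow> \<alpha>" using lim by (simp add: b_def [abs_def] o_def)
  define c where "c = 4 * (1 + C) + 2 * \<bar>L\<bar>"
  have c0: "c \<ge> 0" using C by (simp add: c_def)
  have D_le: "D \<rho> \<le> c * \<rho> powr (real n + 1 / 2)" if "\<rho> \<ge> 1" "\<rho> \<ge> r0" for \<rho>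
  proof -
    have 1: "nevanlinna_T F \<rho> \<le> \<rho> powr (real n + 1 / 2)" using T that by simp
    have 2: "C * \<rho> powr s \<le> C * \<rho> powr (real n + 1 / 2)"
      using that C s by (intro mult_left_mono powr_mono) auto
    have "- L \<le> \<bar>L\<bar> * 1" by simp
    also have "\<dots> \<le> \<bar>L\<bar> * \<rho> powr (real n + 1 / 2)"
      using that by (intro mult_left_mono ge_one_powr_ge_zero) auto
    finally show ?thesis using 1 2 by (simp add: D_def c_def algebra_simps)
  qed
  define C' where "C' = C + \<bar>L\<bar> + real n * M"
  have main: "norm (F z) \<le> exp (C' * norm z powr s + Re (\<alpha> * z ^ n))" if z: "norm z \<ge> 1" for z
  proof -
    define r where "r = norm z"
    have r: "r \<ge> 1" using z by (simp add: r_def)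
    define \<tau> where "\<tau> i = 2 * c * r ^ Suc n * (real i - 1) powr (- (1 / 2))" for i :: nat
    have step: "norm (F z) \<le> exp (C' * r powr s + Re (a i n * z ^ n) + \<tau> i)"
      if i: "i \<ge> N" "real i - 1 \<ge> 2 * r" "real i - 1 \<ge> r0" for i
    proof -
      \<comment> \<open>The terms of degree greater than \<open>n\<close> are estimated at a radius \<open>\<rho>\<close> that grows with \<open>i\<close>.\<close>
      obtain \<rho> where \<rho>: "real i - 1 \<le> \<rho>" "\<rho> \<le> real i - 1 + 1" "\<And>z. norm z = \<rho> \<Longrightarrow> F z \<noteq> 0"
        using zero_free_circle[OF F(1) ex] by metis
      have \<rho>': "0 < \<rho>" "\<rho> < real (Suc i)" "2 * norm z \<le> \<rho>" "\<rho> \<ge> 1" "\<rho> \<ge> r0"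
        using \<rho> i r by (auto simp: r_def)
      have "norm (h i z - (\<Sum>j\<le>n. a i j * z ^ j)) \<le> 2 * D \<rho> * (norm z / \<rho>) ^ Suc n"
        unfolding a_def
        by (rule taylor_tail_bound[OF h \<rho>'(1,2,3)]) (use coef[OF \<rho>'(1,2) \<rho>(3)] in \<open>simp add: a_def\<close>)
      also have "\<dots> \<le> 2 * (c * \<rho> powr (real n + 1 / 2)) * (r / \<rho>) ^ Suc n"
        unfolding r_def using D_le[OF \<rho>'(4,5)] \<rho>' by (intro mult_right_mono mult_left_mono) auto
      also have "\<dots> = 2 * c * r ^ Suc n * (\<rho> powr (real n + 1 / 2) / \<rho> powr (real (Suc n)))"
        using \<rho>' by (simp only: power_divide powr_realpow) simp
      also have "\<rho> powr (real n + 1 / 2) / \<rho> powr (real (Suc n)) = \<rho> powr (- (1 / 2))"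
        by (simp add: powr_diff [symmetric])
      also have "2 * c * r ^ Suc n * \<rho> powr (- (1 / 2)) \<le> \<tau> i"
        unfolding \<tau>_def using c0 r \<rho> i by (intro mult_left_mono powr_mono2') auto
      finally have tail: "norm (h i z - (\<Sum>j\<le>n. a i j * z ^ j)) \<le> \<tau> i" .
      have low: "norm (a i j * z ^ j) \<le> M * r powr s" if "j \<in> {1..<n}" for j
      proof -
        have "norm (a i j * z ^ j) = norm (a i j) * r ^ j" by (simp add: norm_mult norm_power r_def)
        also have "r ^ j = r powr real j" using r by (simp add: powr_realpow)
        also have "r powr real j \<le> r powr s" using r that s by (intro powr_mono) auto
        also have "norm (a i j) * r powr s \<le> M * r powr s"
          using aM[OF i(1), of j] that by (intro mult_right_mono) auto
        finally show ?thesis by (simp add: mult_left_mono)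
      qed
      have "(\<Sum>j\<le>n. a i j * z ^ j) = h i 0 + (\<Sum>j\<in>{1..<n}. a i j * z ^ j) + a i n * z ^ n"
      proof -
        have "{..n} = insert 0 (insert n {1..<n})" using n by auto
        then show ?thesis using n by (simp add: a_def)
      qed
      then have "Re (h i z) = L + Re (\<Sum>j\<in>{1..<n}. a i j * z ^ j) + Re (a i n * z ^ n) +
          Re (h i z - (\<Sum>j\<le>n. a i j * z ^ j))"
        using h0[of i] by simp
      also have "Re (\<Sum>j\<in>{1..<n}. a i j * z ^ j) \<le> real n * (M * r powr s)"
      proof -
        have "Re (\<Sum>j\<in>{1..<n}. a i j * z ^ j) \<le> norm (\<Sum>j\<in>{1..<n}. a i j * z ^ j)"
          by (rule complex_Re_le_cmod)
        also have "\<dots> \<le> (\<Sum>j\<in>{1..<n}. M * r powr s)" by (rule sum_norm_le) (rule low)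
        also have "\<dots> = real (n - 1) * (M * r powr s)" by simp
        also have "\<dots> \<le> real n * (M * r powr s)" using M0 by (intro mult_right_mono) auto
        finally show ?thesis .
      qed
      also have "Re (h i z - (\<Sum>j\<le>n. a i j * z ^ j)) \<le> \<tau> i"
        using tail complex_Re_le_cmod order.trans by blast
      also have "L \<le> \<bar>L\<bar> * r powr s"
      proof -
        have "L \<le> \<bar>L\<bar> * 1" by simp
        also have "\<dots> \<le> \<bar>L\<bar> * r powr s" using r s by (intro mult_left_mono ge_one_powr_ge_zero) auto
        finally show ?thesis .
      qed
      finally have "C * r powr s + Re (h i z) \<le> C' * r powr s + Re (a i n * z ^ n) + \<tau> i"
        by (simp add: C'_def algebra_simps)
      moreover have "norm (F z) \<le> exp (C * r powr s + Re (h i z))"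
        using Fh[of z i] \<rho>' r unfolding r_def by simp
      ultimately show ?thesis by (meson exp_le_cancel_iff order.trans)
    qed
    have idx: "\<sigma> k \<ge> k" for k using \<sigma> by (rule seq_suble)
    have idxlim: "filterlim (\<lambda>k. \<sigma> k + N) at_top sequentially"
      by (rule filterlim_at_top_mono[OF filterlim_ident]) (intro always_eventually allI trans_le_add1 idx)
    have "filterlim (\<lambda>k. -1 + real (\<sigma> k + N)) at_top sequentially"
      by (rule filterlim_tendsto_add_at_top[OF tendsto_const filterlim_compose[OF filterlim_real_sequentially idxlim]])
    then have flt: "filterlim (\<lambda>k. real (\<sigma> k + N) - 1) at_top sequentially"
      by (simp add: algebra_simps)
    then have "(\<lambda>k. (real (\<sigma> k + N) - 1) powr (- (1 / 2))) \<longlonglongrightarrow> 0"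
      by (intro tendsto_neg_powr) auto
    then have "(\<lambda>k. \<tau> (\<sigma> k + N)) \<longlonglongrightarrow> 2 * c * r ^ Suc n * 0"
      unfolding \<tau>_def by (intro tendsto_mult tendsto_const)
    then have "(\<lambda>k. exp (C' * r powr s + Re (b k * z ^ n) + \<tau> (\<sigma> k + N))) \<longlonglongrightarrow>
        exp (C' * r powr s + Re (\<alpha> * z ^ n) + 2 * c * r ^ Suc n * 0)"
      by (intro tendsto_intros blim)
    moreover have "eventually (\<lambda>k. real (\<sigma> k + N) - 1 \<ge> max (2 * r) r0) sequentially"
      using flt unfolding filterlim_at_top by blast
    then have "eventually (\<lambda>k. norm (F z) \<le> exp (C' * r powr s + Re (b k * z ^ n) + \<tau> (\<sigma> k + N))) sequentially"
      by (rule eventually_mono) (use step in \<open>auto simp: b_def\<close>)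
    ultimately have "norm (F z) \<le> exp (C' * r powr s + Re (\<alpha> * z ^ n) + 2 * c * r ^ Suc n * 0)"
      by (intro tendsto_lowerbound) auto
    then show ?thesis by (simp add: r_def)
  qed
  moreover have "C' \<ge> 0" using C M0 by (simp add: C'_def)
  ultimately show ?thesis by blast
qed

text \<open>
  An exponent below \<open>n\<close> that makes the sum converge can be raised to at least \<open>n - 1\<close>: the nonzero zeros have
  modulus at least some \<open>\<delta> > 0\<close>, so each term changes at most by a constant factor. The sum is bounded
  on finite sets of zeros since only these occur in the canonical products.
\<close>

lemma zero_exponent_less_imp_bounded_sums:
  assumes A: "A holomorphic_on UNIV" "\<exists>z. A z \<noteq> 0" and exp: "zero_exponent A < ereal (real n)" and n: "n > 0"
    and F: "F holomorphic_on UNIV" "F 0 \<noteq> 0" "\<And>z. A z = F z * z ^ k"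
  shows "\<exists>s S. real n - 1 \<le> s \<and> s < real n \<and> s > 0 \<and>
    (\<forall>Z. finite Z \<longrightarrow> Z \<subseteq> {w. F w = 0} \<longrightarrow> (\<Sum>w\<in>Z. real (nat (zorder F w)) * norm w powr (- s)) \<le> S)"
proof -
  have ex: "\<exists>z. F z \<noteq> 0" using F by blast
  have Z0: "w \<noteq> 0" if "F w = 0" for w using that F(2) by auto
  define g where "g s w = real_of_int (zorder A w) * cmod w powr (- s)" for s w
  obtain s0 where s0: "s0 > 0" "s0 < real n" "g s0 summable_on {z. z \<noteq> 0 \<and> A z = 0}"
    using exp unfolding zero_exponent_def g_def [abs_def] by (auto simp: Inf_less_iff)
  have zo: "zorder A w = zorder F w" if "F w = 0" for w
  proof -
    obtain G where G: "G holomorphic_on UNIV" "\<And>z. F z = G z * (z - w) ^ nat (zorder F w)" "G w \<noteq> 0"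
      using divide_zero_entire[OF F(1) ex] by metis
    have "zorder A w = int (nat (zorder F w))"
    proof (rule zorder_entire_eqI)
      show "(\<lambda>z. G z * z ^ k) holomorphic_on UNIV" by (intro holomorphic_intros G)
      show "G w * w ^ k \<noteq> 0" using G(3) Z0[OF that] by simp
    qed (subst F(3), subst G(2), simp add: mult_ac)
    then show ?thesis using zorder_entire(1)[OF F(1) ex, of w] by simp
  qed
  obtain \<delta> where \<delta>: "\<delta> > 0" "\<And>w. F w = 0 \<Longrightarrow> \<delta> \<le> norm w"
  proof -
    have "open {z. F z \<noteq> 0}"
      using continuous_on_entire[OF F(1)] by (simp add: open_Collect_neq)
    then obtain e where e: "e > 0" "ball 0 e \<subseteq> {z. F z \<noteq> 0}"
      using F(2) open_contains_ball by blast
    show ?thesis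
    proof (rule that[OF e(1)])
      fix w assume "F w = 0"
      then have "w \<notin> ball 0 e" using e(2) by blast
      then show "e \<le> norm w" by simp
    qed
  qed
  define s where "s = max s0 (real n - 1)"
  have s: "real n - 1 \<le> s" "s < real n" "s > 0" "s0 \<le> s" using s0 by (auto simp: s_def)
  define S where "S = \<delta> powr (s0 - s) * infsum (g s0) {z. z \<noteq> 0 \<and> A z = 0}"
  have "(\<Sum>w\<in>Z. real (nat (zorder F w)) * norm w powr (- s)) \<le> S" if Z: "finite Z" "Z \<subseteq> {w. F w = 0}" for Z
  proof -
    have gnn: "g s0 w \<ge> 0" for w using zorder_entire(1)[OF A, of w] by (simp add: g_def)
    have "(\<Sum>w\<in>Z. real (nat (zorder F w)) * norm w powr (- s)) \<le> (\<Sum>w\<in>Z. \<delta> powr (s0 - s) * g s0 w)"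
    proof (rule sum_mono)
      fix w assume "w \<in> Z"
      then have w: "F w = 0" using Z by auto
      have "norm w powr (- s) = norm w powr (s0 - s) * norm w powr (- s0)" by (simp add: powr_add [symmetric])
      also have "\<dots> \<le> \<delta> powr (s0 - s) * norm w powr (- s0)"
        using \<delta>(1) \<delta>(2)[OF w] s by (intro mult_right_mono powr_mono2') auto
      finally have "real (nat (zorder F w)) * norm w powr (- s) \<le>
          real (nat (zorder F w)) * (\<delta> powr (s0 - s) * norm w powr (- s0))"
        by (rule mult_left_mono) simp
      also have "\<dots> = \<delta> powr (s0 - s) * g s0 w"
        using zorder_entire(1)[OF F(1) ex, of w] by (simp add: g_def zo[OF w])
      finally show "real (nat (zorder F w)) * norm w powr (- s) \<le> \<delta> powr (s0 - s) * g s0 w" .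
    qed
    also have "\<dots> = \<delta> powr (s0 - s) * (\<Sum>w\<in>Z. g s0 w)" by (simp add: sum_distrib_left)
    also have "\<dots> \<le> S" unfolding S_def
      using Z Z0 F(3) by (intro mult_left_mono finite_sum_le_infsum s0(3) gnn) auto
    finally show ?thesis .
  qed
  then show ?thesis using s by blast
qed

lemma growth_order_le_of_exp_bound:
  assumes A: "A holomorphic_on UNIV" and s: "s > 0" and c: "c \<ge> 0"
    and bound: "\<And>z. norm z \<ge> 1 \<Longrightarrow> norm (A z) \<le> exp (c * norm z powr s)"
  shows "growth_order A \<le> ereal s"
proof -
  have T: "nevanlinna_T A r \<le> c * r powr s" if r: "r \<ge> 1" for r
  proof -
    have "nevanlinna_T A r = circle_mean (\<lambda>z. log_plus (norm (A z))) r"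
      by (rule nevanlinna_T_eq_circle_mean[OF continuous_on_entire[OF A]]) (use r in auto)
    also have "\<dots> \<le> circle_mean (\<lambda>_. c * r powr s) r"
    proof (rule circle_mean_mono)
      fix z :: complex assume "norm z = r"
      then show "log_plus (norm (A z)) \<le> c * r powr s"
        using bound[of z] r c by (subst log_plus_le_iff) auto
    qed (use r A in \<open>auto intro!: continuous_on_log_plus_norm continuous_on_entire\<close>)
    finally show ?thesis by simp
  qed
  have "growth_order A \<le> ereal (s + \<epsilon>)" if \<epsilon>: "\<epsilon> > 0" for \<epsilon>
    unfolding growth_order_def
  proof (rule Limsup_bounded)
    \<comment> \<open>The constant is made at least 1 so that \<open>log_plus\<close> is the logarithm.\<close>
    define c' where "c' = max c 1"
    have "eventually (\<lambda>r::real. ln r \<ge> ln c' / \<epsilon>) at_top"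
      using ln_at_top unfolding filterlim_at_top by blast
    then show "\<forall>\<^sub>F r in at_top. ereal (log_plus (nevanlinna_T A r) / ln r) \<le> ereal (s + \<epsilon>)"
      using eventually_ge_at_top[of 2]
    proof eventually_elim
      case (elim r)
      have "nevanlinna_T A r \<ge> 0"
      proof -
        have "circle_mean (\<lambda>_. 0) r \<le> circle_mean (\<lambda>z. log_plus (norm (A z))) r"
          by (intro circle_mean_mono continuous_on_log_plus_norm continuous_on_entire[OF A]) (use elim in auto)
        then show ?thesis
          using nevanlinna_T_eq_circle_mean[OF continuous_on_entire[OF A], of r] elim by simp
      qed
      then have "log_plus (nevanlinna_T A r) \<le> log_plus (c' * r powr s)"
        using T[of r] elim by (intro log_plus_mono) (auto simp: c'_def intro: order.trans mult_right_mono)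
      also have "1 * 1 \<le> c' * r powr s"
        using elim s by (intro mult_mono ge_one_powr_ge_zero) (auto simp: c'_def)
      then have "log_plus (c' * r powr s) = ln (c' * r powr s)" by (simp add: log_plus_def)
      also have "\<dots> = ln c' + s * ln r" using elim by (simp add: ln_mult_pos c'_def ln_powr)
      also have "\<dots> \<le> \<epsilon> * ln r + s * ln r" using elim \<epsilon> by (simp add: field_simps)
      finally have "log_plus (nevanlinna_T A r) \<le> (s + \<epsilon>) * ln r" by (simp add: algebra_simps)
      then show ?case using elim by (simp add: field_simps)
    qed
  qed
  then have "growth_order A \<le> ereal s + ereal \<epsilon>" if "\<epsilon> > 0" for \<epsilon>
    using that by simp
  then show ?thesis by (rule ereal_le_epsilon2[rule_format])
qed

text \<open>
  If \<open>a\<close> were 0, the bound would make the order of \<open>A\<close> at most \<open>s < n\<close>. A zero at the origin gives the factor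
  \<open>|z|^k\<close>, which is absorbed into \<open>exp (C |z|^s)\<close>.
\<close>

lemma exponential_type_structure:
  assumes A: "A holomorphic_on UNIV" and n: "n > 0"
    and lam: "zero_exponent A < growth_order A" and ord: "growth_order A = ereal (real n)"
  shows "\<exists>a C s. a \<noteq> 0 \<and> C \<ge> 0 \<and> 0 < s \<and> s < real n \<and>
    (\<forall>z. norm z \<ge> 1 \<longrightarrow> norm (A z) \<le> exp (C * norm z powr s + Re (a * z ^ n)))"
proof -
  have ex: "\<exists>z. A z \<noteq> 0"
  proof (rule ccontr)
    assume "\<not> (\<exists>z. A z \<noteq> 0)"
    then have "growth_order A \<le> ereal (1 / 2)"
      by (intro growth_order_le_of_exp_bound[of _ _ 0] A) auto
    then show False using ord n by simp
  qed
  obtain F k where F: "F holomorphic_on UNIV" "F 0 \<noteq> 0" "\<And>z. A z = F z * z ^ k"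
    "\<And>r. r \<ge> 1 \<Longrightarrow> nevanlinna_T F r \<le> nevanlinna_T A r"
    using split_off_zero_at_origin[OF A ex] by metis
  obtain s S where s: "real n - 1 \<le> s" "s < real n" "s > 0" and
    S: "\<And>Z. finite Z \<Longrightarrow> Z \<subseteq> {w. F w = 0} \<Longrightarrow> (\<Sum>w\<in>Z. real (nat (zorder F w)) * norm w powr (- s)) \<le> S"
    using zero_exponent_less_imp_bounded_sums[OF A ex lam[unfolded ord] n F(1-3)] by blast
  have "growth_order A < ereal (real n + 1 / 2)" using ord by simp
  then obtain r0 where r0: "r0 \<ge> 1" "\<And>r. r \<ge> r0 \<Longrightarrow> nevanlinna_T A r \<le> r powr (real n + 1 / 2)"
    using growth_order_less_imp_eventually by blast
  have TF: "nevanlinna_T F r \<le> r powr (real n + 1 / 2)" if "r \<ge> r0" for r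
    using F(4)[of r] r0(1) r0(2)[OF that] that by simp
  obtain a C where C: "C \<ge> 0" and
    bound: "\<And>z. norm z \<ge> 1 \<Longrightarrow> norm (F z) \<le> exp (C * norm z powr s + Re (a * z ^ n))"
    using hadamard_bound[OF F(1,2) n s S TF] by blast
  define C' where "C' = C + real k / s"
  have C': "C' \<ge> 0" using C s by (simp add: C'_def)
  have bound': "norm (A z) \<le> exp (C' * norm z powr s + Re (a * z ^ n))" if z: "norm z \<ge> 1" for z
  proof -
    have "norm z > 0" using z by linarith
    then have "norm z ^ k = exp (real k * ln (norm z))" by (simp add: exp_of_nat_mult)
    also have "\<dots> \<le> exp (real k * (norm z powr s / s))"
      using mult_left_mono[OF ln_powr_bound[OF z s(3)], of "real k"] by simp
    finally have "norm (A z) \<le> exp (C * norm z powr s + Re (a * z ^ n)) * exp (real k * (norm z powr s / s))"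
      using bound[OF z] by (simp add: F(3)[of z] norm_mult norm_power mult_mono)
    also have "\<dots> = exp (C' * norm z powr s + Re (a * z ^ n))"
      by (simp add: C'_def exp_add [symmetric] algebra_simps)
    finally show ?thesis .
  qed
  have "a \<noteq> 0"
  proof
    assume "a = 0"
    then have "growth_order A \<le> ereal s"
      using bound' by (intro growth_order_le_of_exp_bound[OF A s(3) C']) auto
    then show False using ord s by simp
  qed
  with C' s bound' show ?thesis
    by (intro exI[of _ a] exI[of _ C'] exI[of _ s]) simp
qed

text \<open>
  The direction \<open>\<theta>0\<close> is chosen with \<open>Re (a z^n) = - |a| r^n\<close>; over an angle of \<open>1/n\<close> the cosine that
  appears stays above \<open>cos 1 > 1/2\<close>, and \<open>r^n\<close> beats \<open>r^s\<close>.
\<close>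

lemma small_sector:
  assumes A: "A holomorphic_on UNIV" and n: "n > 0"
    and lam: "zero_exponent A < growth_order A" and ord: "growth_order A = ereal (real n)"
  shows "\<exists>\<theta>0 x0. x0 \<ge> 1 \<and>
    (\<forall>r\<ge>x0. \<forall>\<theta>\<in>{\<theta>0..\<theta>0 + 1 / real n}. norm (A (of_real r * exp (\<i> * of_real \<theta>))) \<le> 1) \<and>
    (\<forall>z. norm z \<ge> x0 \<longrightarrow> norm (A z) \<le> exp (norm z ^ (n + 1)))"
proof -
  obtain a C s where a: "a \<noteq> 0" and C: "C \<ge> 0" and s: "0 < s" "s < real n" and
    bound: "\<And>z. norm z \<ge> 1 \<Longrightarrow> norm (A z) \<le> exp (C * norm z powr s + Re (a * z ^ n))"
    using exponential_type_structure[OF assms] by blast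
  define \<theta>0 where "\<theta>0 = (pi - Arg a) / real n"
  define q where "q = 2 * C / norm a"
  define x0 where "x0 = max (max 1 (C + norm a)) ((q + 1) powr (1 / (real n - s)))"
  have q0: "q \<ge> 0" using C by (simp add: q_def)
  have pow: "r ^ n = r powr s * r powr (real n - s)" if "r \<ge> 1" for r :: real
  proof -
    have "r ^ n = r powr real n" using that by (simp add: powr_realpow)
    then show ?thesis by (simp add: powr_add [symmetric])
  qed
  have small: "norm (A (of_real r * exp (\<i> * of_real \<theta>))) \<le> 1"
    if r: "r \<ge> x0" and \<theta>: "\<theta> \<in> {\<theta>0..\<theta>0 + 1 / real n}" for r \<theta>
  proof -
    define z where "z = of_real r * exp (\<i> * of_real \<theta>)"
    have r1: "r \<ge> 1" using r by (simp add: x0_def)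
    have nz: "norm z = r" using r1 by (simp add: z_def norm_mult)
    have polar: "Re (of_real x * exp (\<i> * of_real y)) = x * cos y" for x y
      by (simp add: Re_exp)
    define t where "t = real n * (\<theta> - \<theta>0)"
    have t: "0 \<le> t" "t \<le> 1" using \<theta> n by (auto simp: t_def field_simps)
    have "a * z ^ n = of_real (norm a) * exp (\<i> * of_real (Arg a)) * (of_real r ^ n * exp (\<i> * of_real \<theta>) ^ n)"
      using a by (simp add: z_def power_mult_distrib Arg_eq)
    also have "\<dots> = of_real (norm a * r ^ n) * exp (\<i> * of_real (Arg a + real n * \<theta>))"
      by (simp add: exp_of_nat_mult [symmetric] exp_add [symmetric] algebra_simps mult_exp_exp)
    also have "Arg a + real n * \<theta> = t + pi" using n by (simp add: t_def \<theta>0_def field_simps)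
    finally have "Re (a * z ^ n) = norm a * r ^ n * cos (t + pi)"
      by (simp only: polar)
    then have "Re (a * z ^ n) = - (norm a * r ^ n * cos t)" by simp
    moreover have "cos t \<ge> 1 / 2"
      using cos_monotone_0_pi_le[of t "pi / 3"] t pi_gt3 by (simp add: cos_60)
    then have "norm a * r ^ n * (1 / 2) \<le> norm a * r ^ n * cos t"
      using r1 by (intro mult_left_mono) auto
    moreover have "C * r powr s \<le> norm a * r ^ n * (1 / 2)"
    proof -
      have "(q + 1) powr (1 / (real n - s)) \<le> r" using r by (simp add: x0_def)
      then have "((q + 1) powr (1 / (real n - s))) powr (real n - s) \<le> r powr (real n - s)"
        using s by (intro powr_mono2) auto
      then have "q \<le> r powr (real n - s)" using s q0 by (simp add: powr_powr)
      then have "r powr s * q \<le> r ^ n" unfolding pow[OF r1] by (intro mult_left_mono) auto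
      then have "norm a * (r powr s * q) \<le> norm a * r ^ n" by (intro mult_left_mono) auto
      then show ?thesis using a by (simp add: q_def algebra_simps)
    qed
    ultimately have "C * norm z powr s + Re (a * z ^ n) \<le> 0" unfolding nz by linarith
    then have "exp (C * norm z powr s + Re (a * z ^ n)) \<le> 1" by simp
    with bound[of z] have "norm (A z) \<le> 1" using nz r1 by linarith
    then show ?thesis by (simp add: z_def)
  qed
  have large: "norm (A z) \<le> exp (norm z ^ (n + 1))" if z: "norm z \<ge> x0" for z
  proof -
    have z1: "norm z \<ge> 1" "norm z \<ge> C + norm a" using z by (auto simp: x0_def)
    have "C * norm z powr s \<le> C * norm z powr real n"
      using C s z1 by (intro mult_left_mono powr_mono) auto
    also have "norm z powr real n = norm z ^ n" using z1 by (intro powr_realpow) auto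
    finally have "C * norm z powr s + Re (a * z ^ n) \<le> C * norm z ^ n + norm a * norm z ^ n"
      using complex_Re_le_cmod[of "a * z ^ n"] by (simp add: norm_mult norm_power)
    also have "\<dots> = (C + norm a) * norm z ^ n" by (simp add: algebra_simps)
    also have "\<dots> \<le> norm z * norm z ^ n" using z1 by (intro mult_right_mono) auto
    finally have "exp (C * norm z powr s + Re (a * z ^ n)) \<le> exp (norm z ^ (n + 1))" by simp
    with bound[OF z1(1)] show ?thesis by linarith
  qed
  have "x0 \<ge> 1" by (simp add: x0_def)
  with small large show ?thesis
    by (intro exI[of _ \<theta>0] exI[of _ x0]) simp
qed

section \<open>Power series with gaps\<close>

text \<open>
  The operation \<open>g l \<mapsto> g (l + 1) - w j * g l\<close> on sequences removes the frequency \<open>w j\<close>, multiplies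
  the coefficient of \<open>w s\<close> by \<open>w s - w j\<close>, and at most doubles the bound. Applying it for all \<open>j\<close> leaves
  only the term of \<open>s\<close>.
\<close>

lemma exponential_sum_coefficient_bound:
  fixes w d :: "'a \<Rightarrow> complex"
  assumes "finite J" "s \<notin> J" "\<And>j. j \<in> J \<Longrightarrow> norm (w j) \<le> 1"
    and "\<And>l. l \<le> card J \<Longrightarrow> norm (\<Sum>i\<in>insert s J. d i * w i ^ l) \<le> M"
  shows "norm (d s) * (\<Prod>j\<in>J. norm (w s - w j)) \<le> 2 ^ card J * M"
  using assms
proof (induction J arbitrary: d M rule: finite_induct)
  case empty
  then show ?case using empty(3)[of 0] by simp
next
  case (insert j J)
  define d' where "d' i = d i * (w i - w j)" for i
  have "norm (d' s) * (\<Prod>j\<in>J. norm (w s - w j)) \<le> 2 ^ card J * (2 * M)"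
  proof (rule insert.IH)
    fix l assume l: "l \<le> card J"
    have fin: "finite (insert s J)" and nin: "j \<notin> insert s J"
      using insert by auto
    have "(\<Sum>i\<in>insert s J. d' i * w i ^ l) =
          (\<Sum>i\<in>insert j (insert s J). d' i * w i ^ l)"
      using fin nin by (simp add: d'_def)
    also have "\<dots> = (\<Sum>i\<in>insert s (insert j J). d i * w i ^ Suc l) -
                  w j * (\<Sum>i\<in>insert s (insert j J). d i * w i ^ l)"
      by (simp only: insert_commute[of j s] sum_distrib_left sum_subtractf [symmetric])
         (simp add: d'_def algebra_simps)
    also have "norm \<dots> \<le> M + 1 * M"
    proof (intro order.trans[OF norm_triangle_ineq4] add_mono)
      show "norm (\<Sum>i\<in>insert s (insert j J). d i * w i ^ Suc l) \<le> M"
        using insert l by (intro insert.prems) auto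
      have "norm (\<Sum>i\<in>insert s (insert j J). d i * w i ^ l) \<le> M"
        using insert l by (intro insert.prems) auto
      then show "norm (w j * (\<Sum>i\<in>insert s (insert j J). d i * w i ^ l)) \<le> 1 * M"
        unfolding norm_mult using insert.prems(2)[of j] by (intro mult_mono) auto
    qed
    finally show "norm (\<Sum>i\<in>insert s J. d' i * w i ^ l) \<le> 2 * M" by simp
  qed (use insert in auto)
  then show ?case
    using insert by (simp add: d'_def norm_mult mult_ac)
qed

lemma fact_card_le_prod:
  fixes X :: "nat set"
  assumes "finite X" "0 \<notin> X"
  shows "fact (card X) \<le> \<Prod>X"
  using assms
proof (induction "card X" arbitrary: X)
  case 0
  then show ?case by simp
next
  case (Suc k)
  then have ne: "X \<noteq> {}" by auto
  have mX: "Max X \<in> X" using Suc.prems ne by (intro Max_in) auto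
  have "X \<subseteq> {1..Max X}" using Suc.prems by (auto simp: Suc_le_eq intro!: gr0I)
  then have "card X \<le> card {1..Max X}" by (intro card_mono) auto
  then have c: "card X \<le> Max X" by simp
  have k: "k = card (X - {Max X})" using Suc mX by simp
  have "fact (card X) = card X * fact (card (X - {Max X}))"
    using Suc.hyps(2) k by (metis fact_Suc of_nat_id)
  also have "\<dots> \<le> Max X * \<Prod>(X - {Max X})"
    using Suc.prems k by (intro mult_mono c Suc.hyps(1)) auto
  also have "\<dots> = \<Prod>X"
    using Suc.prems mX by (simp add: prod.remove)
  finally show ?case .
qed

text \<open>
  If \<open>a\<close> elements of \<open>J\<close> lie below \<open>s\<close> and \<open>b\<close> above, the product of the distances is at least
  \<open>a! b!\<close>, which is \<open>(a + b)!\<close> divided by a binomial coefficient.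
\<close>

lemma fact_card_le_prod_dist:
  fixes J :: "nat set"
  assumes "finite J" "s \<notin> J"
  shows "fact (card J) \<le> 2 ^ card J * (\<Prod>j\<in>J. \<bar>real s - real j\<bar>)"
proof -
  define A where "A = {j \<in> J. j < s}"
  define B where "B = {j \<in> J. s < j}"
  have J: "J = A \<union> B" "A \<inter> B = {}" "finite A" "finite B"
    using assms nat_neq_iff by (auto simp: A_def B_def)
  have cJ: "card J = card A + card B" using J card_Un_disjoint by blast
  have injA: "inj_on (\<lambda>j. s - j) A" and injB: "inj_on (\<lambda>j. j - s) B"
    by (auto simp: inj_on_def A_def B_def)
  have "fact (card ((\<lambda>j. s - j) ` A)) \<le> \<Prod>((\<lambda>j. s - j) ` A)"
    by (rule fact_card_le_prod) (use J(3) in \<open>auto simp: A_def\<close>)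
  then have "fact (card A) \<le> (\<Prod>j\<in>A. s - j)"
    using injA by (simp add: card_image prod.reindex)
  then have "real (fact (card A)) \<le> real (\<Prod>j\<in>A. s - j)" by (rule of_nat_mono)
  also have "\<dots> = (\<Prod>j\<in>A. \<bar>real s - real j\<bar>)"
    unfolding of_nat_prod by (rule prod.cong) (auto simp: A_def)
  finally have a: "fact (card A) \<le> (\<Prod>j\<in>A. \<bar>real s - real j\<bar>)" by simp
  have "fact (card ((\<lambda>j. j - s) ` B)) \<le> \<Prod>((\<lambda>j. j - s) ` B)"
    by (rule fact_card_le_prod) (use J(4) in \<open>auto simp: B_def\<close>)
  then have "fact (card B) \<le> (\<Prod>j\<in>B. j - s)"
    using injB by (simp add: card_image prod.reindex)
  then have "real (fact (card B)) \<le> real (\<Prod>j\<in>B. j - s)" by (rule of_nat_mono)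
  also have "\<dots> = (\<Prod>j\<in>B. \<bar>real s - real j\<bar>)"
    unfolding of_nat_prod by (rule prod.cong) (auto simp: B_def)
  finally have b: "fact (card B) \<le> (\<Prod>j\<in>B. \<bar>real s - real j\<bar>)" by simp
  have "fact (card J) = (fact (card A) * fact (card B)) * real (card J choose card A)"
    by (simp add: cJ binomial_fact)
  also have "\<dots> \<le> ((\<Prod>j\<in>A. \<bar>real s - real j\<bar>) * (\<Prod>j\<in>B. \<bar>real s - real j\<bar>)) * 2 ^ card J"
  proof (rule mult_mono)
    have "card J choose card A \<le> 2 ^ card J" by (rule binomial_le_pow2)
    then show "real (card J choose card A) \<le> 2 ^ card J"
      using of_nat_mono by fastforce
  qed (use a b in \<open>auto intro!: mult_mono prod_nonneg mult_nonneg_nonneg\<close>)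
  also have "\<dots> = 2 ^ card J * (\<Prod>j\<in>J. \<bar>real s - real j\<bar>)"
    using J(2-4) by (subst (2) J(1)) (simp add: prod.union_disjoint mult_ac)
  finally show ?thesis .
qed

text \<open>
  The sample points have spacing \<open>1/(2 T)\<close>, so that they occupy an arc of length less than
  \<open>card S / (2 T)\<close>, while different frequencies \<open>s\<close> and \<open>j\<close> still rotate by angles that differ by at
  least a constant times \<open>|s - j| / T\<close>. With \<open>m = card S - 1\<close> this gives the factor \<open>(16 T)^m / m!\<close>,
  and \<open>(\<eta> T)^m / m! \<le> exp (\<eta> T)\<close>. The resulting bound is
  \<open>exp (o(T)) M\<close> when \<open>card S = o(T)\<close>, by letting \<open>\<eta>\<close> tend to 0.
\<close>

lemma trig_polynomial_coefficient_bound: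
  fixes c :: "nat \<Rightarrow> complex" and T :: nat and \<eta> \<theta> M :: real
  assumes "S \<subseteq> {..T}" "T > 0" "0 < \<eta>" "\<eta> \<le> 16" "s \<in> S"
    and M: "\<And>l. l < card S \<Longrightarrow>
      norm (\<Sum>i\<in>S. c i * exp (\<i> * of_real (real i * (\<theta> + real l / (2 * real T))))) \<le> M"
  shows "norm (c s) \<le> (16 / \<eta>) ^ card S * exp (\<eta> * T) * M"
proof -
  define J where "J = S - {s}"
  have finS: "finite S" using assms(1) finite_subset by blast
  then have J: "finite J" "s \<notin> J" "insert s J = S" "card S = Suc (card J)"
    using assms(5) card.remove[OF finS assms(5)] by (auto simp: J_def)
  define m where "m = card J"
  define w where "w i = exp (\<i> * of_real (real i / (2 * real T)))" for i :: nat
  define d where "d i = c i * exp (\<i> * of_real (real i * \<theta>))" for i :: nat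
  have M0: "M \<ge> 0" using order.trans[OF norm_ge_zero M[of 0]] J(4) by simp
  have main: "norm (d s) * (\<Prod>j\<in>J. norm (w s - w j)) \<le> 2 ^ m * M"
    unfolding m_def
  proof (rule exponential_sum_coefficient_bound)
    fix l assume "l \<le> card J"
    then have l: "l < card S" using J by simp
    have "d i * w i ^ l = c i * exp (\<i> * of_real (real i * (\<theta> + real l / (2 * real T))))" for i
      by (simp add: d_def w_def exp_of_nat_mult [symmetric] exp_add [symmetric] algebra_simps)
    then show "norm (\<Sum>i\<in>insert s J. d i * w i ^ l) \<le> M"
      using M[OF l] J(3) by simp
  qed (use J(1,2) in \<open>auto simp: w_def\<close>)
  have w: "\<bar>real s - real j\<bar> / (4 * T) \<le> norm (w s - w j)" if "j \<in> J" for j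
  proof -
    define x where "x = (real s - real j) / (2 * real T)"
    have "s \<le> T" "j \<le> T" using that assms by (auto simp: J_def)
    then have "\<bar>real s - real j\<bar> \<le> real T" by linarith
    then have x: "\<bar>x\<bar> \<le> 1/2" using assms(2) by (simp add: x_def field_simps)
    have "real s / (2 * real T) = real j / (2 * real T) + x"
      by (simp add: x_def diff_divide_distrib)
    then have "w s = w j * exp (\<i> * of_real x)"
      by (simp only: w_def of_real_add distrib_left exp_add)
    then have "w s - w j = w j * (exp (\<i> * of_real x) - 1)" by (simp add: algebra_simps)
    then have "norm (w s - w j) = norm (exp (\<i> * of_real x) - 1)"
      by (simp add: norm_mult w_def)
    also have "\<dots> \<ge> 1 / 2 * norm (\<i> * of_real x)"
      by (rule norm_exp_bounds) (use x in \<open>simp add: norm_mult\<close>)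
    also have "norm (\<i> * complex_of_real x) = \<bar>real s - real j\<bar> / (2 * T)"
      using assms(2) by (simp only: norm_mult norm_of_real x_def) simp
    finally show ?thesis by simp
  qed
  have "fact m / (2 ^ m * (4 * real T) ^ m) \<le> (\<Prod>j\<in>J. \<bar>real s - real j\<bar> / (4 * T))"
    using fact_card_le_prod_dist[OF J(1,2)] assms(2)
    by (simp add: prod_dividef m_def field_simps)
  also have "\<dots> \<le> (\<Prod>j\<in>J. norm (w s - w j))"
    by (intro prod_mono conjI w) auto
  finally have "norm (d s) * (fact m / (2 ^ m * (4 * real T) ^ m)) \<le> 2 ^ m * M"
    using main by (meson mult_left_mono norm_ge_zero order.trans)
  then have "norm (d s) \<le> (2 ^ m * M) * (2 ^ m * (4 * real T) ^ m) / fact m"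
    using assms(2) by (simp add: field_simps)
  also have "\<dots> = (16 * real T) ^ m / fact m * M"
  proof -
    have "(16 :: real) ^ m = 2 ^ m * 2 ^ m * 4 ^ m"
      unfolding power_mult_distrib [symmetric] by simp
    then show ?thesis by (simp add: power_mult_distrib mult_ac)
  qed
  also have "\<dots> \<le> ((16 / \<eta>) ^ card S * exp (\<eta> * T)) * M"
  proof (rule mult_right_mono[OF _ M0])
    have "(16 * real T) ^ m / fact m = (16 / \<eta>) ^ m * ((\<eta> * T) ^ m / fact m)"
      using assms by (simp add: power_mult_distrib power_divide)
    also have "\<dots> \<le> (16 / \<eta>) ^ card S * exp (\<eta> * T)"
    proof (intro mult_mono)
      show "(16 / \<eta>) ^ m \<le> (16 / \<eta>) ^ card S"
        using assms J by (intro power_increasing) (auto simp: m_def)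
      have "(\<Sum>n\<in>{m}. (\<eta> * real T) ^ n /\<^sub>R fact n) \<le> (\<Sum>n. (\<eta> * real T) ^ n /\<^sub>R fact n)"
        by (rule sum_le_suminf[OF summable_exp_generic]) (use assms in auto)
      then show "(\<eta> * T) ^ m / fact m \<le> exp (\<eta> * T)" by (simp add: exp_def field_simps)
    qed (use assms in auto)
    finally show "(16 * real T) ^ m / fact m \<le> (16 / \<eta>) ^ card S * exp (\<eta> * T)" .
  qed
  finally show ?thesis by (simp add: d_def norm_mult)
qed

lemma strict_mono_ge_id: "strict_mono (l :: nat \<Rightarrow> nat) \<Longrightarrow> k \<le> l k"
  by (rule seq_suble)

lemma finite_exponents_le:
  assumes "strict_mono (l :: nat \<Rightarrow> nat)"
  shows "finite {k. l k \<le> T}"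
  by (rule finite_subset[of _ "{..T}"]) (use strict_mono_ge_id[OF assms] order.trans in auto)

text \<open>
  Each exponent at most \<open>T\<close> contributes at least \<open>1/T\<close> to the convergent series, whose tails are small.
\<close>

lemma fejer_gaps_density_zero:
  assumes l: "strict_mono (l :: nat \<Rightarrow> nat)" and sum: "summable (\<lambda>k. 1 / real (l k))" and \<eta>: "\<eta> > 0"
  shows "\<exists>T0. \<forall>T\<ge>T0. real (card {k. l k \<le> T}) \<le> \<eta> * real T"
proof -
  obtain k0 where k0: "\<And>m n. m \<ge> k0 \<Longrightarrow> norm (\<Sum>k=m..<n. 1 / real (l k)) < \<eta> / 2"
    using sum \<eta> unfolding summable_Cauchy by (meson half_gt_zero)
  define m where "m = max k0 1"
  define T0 where "T0 = nat \<lceil>2 * real m / \<eta>\<rceil>"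
  have "real (card {k. l k \<le> T}) \<le> \<eta> * real T" if T: "T \<ge> T0" for T
  proof -
    define K where "K = {k \<in> {m..<Suc T}. l k \<le> T}"
    have sub: "{k. l k \<le> T} \<subseteq> {..<m} \<union> K"
      using strict_mono_ge_id[OF l] by (auto simp: K_def not_less less_Suc_eq_le intro: order.trans)
    have "real (card {k. l k \<le> T}) \<le> real (card ({..<m} \<union> K))"
      unfolding of_nat_le_iff by (rule card_mono[OF _ sub]) (auto simp: K_def)
    also have "\<dots> \<le> real m + real (card K)"
      using card_Un_le[of "{..<m}" K] by simp
    also have "real (card K) = (\<Sum>k\<in>K. 1)" by simp
    also have "\<dots> \<le> (\<Sum>k\<in>K. real T * (1 / real (l k)))"
    proof (rule sum_mono)
      fix k assume "k \<in> K"
      then have "m \<le> k" "l k \<le> T" by (auto simp: K_def)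
      moreover have "k \<le> l k" by (rule strict_mono_ge_id[OF l])
      ultimately have "l k > 0" "l k \<le> T" by (auto simp: m_def)
      then show "1 \<le> real T * (1 / real (l k))" by (simp add: le_divide_eq)
    qed
    also have "\<dots> \<le> (\<Sum>k=m..<Suc T. real T * (1 / real (l k)))"
      by (rule sum_mono2) (auto simp: K_def)
    also have "\<dots> = real T * (\<Sum>k=m..<Suc T. 1 / real (l k))" by (rule sum_distrib_left [symmetric])
    also have "\<dots> \<le> real T * (\<eta> / 2)"
      using k0[of m "Suc T"] by (intro mult_left_mono) (auto simp: m_def abs_less_iff)
    finally have 1: "real (card {k. l k \<le> T}) \<le> real m + real T * (\<eta> / 2)" by simp
    have "2 * real m / \<eta> \<le> real T" using T unfolding T0_def by linarith
    then have "real m \<le> real T * (\<eta> / 2)" using \<eta> by (simp add: field_simps)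
    with 1 show ?thesis by (simp add: field_simps)
  qed
  then show ?thesis by blast
qed

text \<open>
  For \<open>T\<close> large the number of exponents at most \<open>T\<close> is so small compared with \<open>T\<close> that the sample points of
  \<open>trig_polynomial_coefficient_bound\<close> fit into the arc and \<open>(16/\<eta>)^(card S) \<le> exp (\<eta> T)\<close>.
\<close>

lemma gap_polynomial_coefficient_bound:
  assumes l: "strict_mono (l :: nat \<Rightarrow> nat)" and sum: "summable (\<lambda>k. 1 / real (l k))"
    and \<eta>: "0 < \<eta>" "\<eta> \<le> 1" and \<delta>: "\<delta> > 0"
  shows "\<exists>T0. \<forall>T\<ge>T0. \<forall>c \<theta>0 M.
    (\<forall>\<theta>\<in>{\<theta>0..\<theta>0 + \<delta>}. norm (\<Sum>k | l k \<le> T. c k * exp (\<i> * of_real (real (l k) * \<theta>))) \<le> M) \<longrightarrow>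
    (\<Sum>k | l k \<le> T. norm (c k)) \<le> exp (3 * \<eta> * real T) * M"
proof -
  define \<kappa> where "\<kappa> = ln (16 / \<eta>)"
  have \<kappa>: "\<kappa> > 0" using \<eta> by (simp add: \<kappa>_def ln_gt_zero)
  obtain T1 where T1: "\<And>T. T \<ge> T1 \<Longrightarrow> real (card {k. l k \<le> T}) \<le> (\<eta> / \<kappa>) * real T"
    using fejer_gaps_density_zero[OF l sum, of "\<eta> / \<kappa>"] \<eta> \<kappa> by auto
  obtain T2 where T2: "\<And>T. T \<ge> T2 \<Longrightarrow> real (card {k. l k \<le> T}) \<le> \<delta> * real T"
    using fejer_gaps_density_zero[OF l sum \<delta>] by auto
  have "(\<Sum>k | l k \<le> T. norm (c k)) \<le> exp (3 * \<eta> * real T) * M"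
    if T: "T \<ge> max 1 (max T1 T2)" and
      M: "\<And>\<theta>. \<theta> \<in> {\<theta>0..\<theta>0 + \<delta>} \<Longrightarrow> norm (\<Sum>k | l k \<le> T. c k * exp (\<i> * of_real (real (l k) * \<theta>))) \<le> M"
    for T c \<theta>0 M
  proof -
    define K where "K = {k. l k \<le> T}"
    define S where "S = l ` K"
    have inj: "inj_on l K" using l strict_mono_imp_inj_on inj_on_subset by blast
    have finK: "finite K" unfolding K_def by (rule finite_exponents_le[OF l])
    have cardS: "card S = card K" unfolding S_def by (rule card_image[OF inj])
    have M0: "M \<ge> 0" using order.trans[OF norm_ge_zero M[of \<theta>0]] \<delta> by simp
    have pow: "(16 / \<eta>) ^ card K \<le> exp (\<eta> * T)"
    proof -
      have "(16 / \<eta>) ^ card K = exp (real (card K) * \<kappa>)"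
        using \<eta> by (simp add: \<kappa>_def exp_of_nat_mult)
      also have "real (card K) * \<kappa> \<le> \<eta> * T"
        using T1[of T] T \<kappa> by (simp add: K_def field_simps)
      finally show ?thesis by simp
    qed
    have each: "norm (c k) \<le> exp (2 * \<eta> * T) * M" if k: "k \<in> K" for k
    proof -
      have "norm ((c \<circ> the_inv_into K l) (l k)) \<le> (16 / \<eta>) ^ card S * exp (\<eta> * T) * M"
      proof (rule trig_polynomial_coefficient_bound[where S = S and T = T and \<theta> = \<theta>0
            and c = "c \<circ> the_inv_into K l" and s = "l k"])
        fix i assume i: "i < card S"
        have "real i / (2 * real T) \<le> \<delta>"
        proof -
          have "real i \<le> \<delta> * real T" using i T2[of T] T unfolding cardS K_def by simp
          also have "\<dots> \<le> \<delta> * (2 * real T)" using \<delta> by simp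
          finally show ?thesis using T by (simp add: divide_le_eq)
        qed
        then have "\<theta>0 + real i / (2 * real T) \<in> {\<theta>0..\<theta>0 + \<delta>}" by simp
        from M[OF this] have "norm (\<Sum>j\<in>K. c j *
            exp (\<i> * of_real (real (l j) * (\<theta>0 + real i / (2 * real T))))) \<le> M"
          unfolding K_def .
        moreover have "(\<Sum>j\<in>S. (c \<circ> the_inv_into K l) j *
            exp (\<i> * of_real (real j * (\<theta>0 + real i / (2 * real T))))) =
          (\<Sum>j\<in>K. c j * exp (\<i> * of_real (real (l j) * (\<theta>0 + real i / (2 * real T)))))"
          unfolding S_def sum.reindex[OF inj] o_def
          by (rule sum.cong) (simp_all only: the_inv_into_f_f[OF inj])
        ultimately show "norm (\<Sum>j\<in>S. (c \<circ> the_inv_into K l) j *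
            exp (\<i> * of_real (real j * (\<theta>0 + real i / (2 * real T))))) \<le> M"
          by (simp only:)
      qed (use \<eta> T k in \<open>auto simp: S_def K_def\<close>)
      also have "(c \<circ> the_inv_into K l) (l k) = c k" by (simp add: the_inv_into_f_f[OF inj k])
      also have "(16 / \<eta>) ^ card S * exp (\<eta> * T) * M \<le> exp (\<eta> * T) * exp (\<eta> * T) * M"
        unfolding cardS by (intro mult_right_mono pow M0) auto
      also have "exp (\<eta> * T) * exp (\<eta> * T) = exp (2 * \<eta> * T)" by (simp add: exp_add [symmetric])
      finally show ?thesis .
    qed
    have "real (card K) \<le> 2 ^ card K" by (rule of_nat_less_two_power[THEN less_imp_le])
    also have "\<dots> \<le> (16 / \<eta>) ^ card K" using \<eta> by (intro power_mono) (auto simp: le_divide_eq)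
    also note pow
    finally have cK: "real (card K) \<le> exp (\<eta> * T)" .
    have "(\<Sum>k\<in>K. norm (c k)) \<le> (\<Sum>k\<in>K. exp (2 * \<eta> * T) * M)" by (rule sum_mono[OF each])
    also have "\<dots> = real (card K) * (exp (2 * \<eta> * T) * M)" by simp
    also have "\<dots> \<le> exp (\<eta> * T) * (exp (2 * \<eta> * T) * M)"
      using M0 cK by (intro mult_right_mono) auto
    also have "\<dots> = exp (\<eta> * T + 2 * \<eta> * T) * M" by (simp only: exp_add mult.assoc)
    also have "\<eta> * T + 2 * \<eta> * T = 3 * \<eta> * T" by simp
    finally show ?thesis by (simp add: K_def)
  qed
  then show ?thesis by (intro exI[of _ "max 1 (max T1 T2)"]) blast
qed

lemma gap_series_taylor_coefficient:
  fixes a :: "nat \<Rightarrow> complex"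
  assumes l: "strict_mono l" and B: "\<And>z. (\<lambda>k. a k * z ^ l k) sums B z"
  shows "(deriv ^^ l k) B 0 / fact (l k) = a k"
proof -
  define c where "c n = (if n \<in> range l then a (inv l n) else 0)" for n
  have inj: "inj l" using l by (rule strict_mono_imp_inj_on)
  have cl: "c (l k) = a k" for k by (simp add: c_def inv_f_f[OF inj])
  have "(\<lambda>n. c n * z ^ n) sums B z" for z
  proof -
    have "(\<lambda>k. c (l k) * z ^ l k) sums B z" using B[of z] by (simp add: cl)
    then show ?thesis
      by (subst (asm) sums_mono_reindex[OF l, where f = "\<lambda>n. c n * z ^ n"]) (auto simp: c_def)
  qed
  then have "B has_fps_expansion Abs_fps c"
    by (intro has_fps_expansionI) simp
  from fps_nth_fps_expansion[OF this, of "l k"] show ?thesis by (simp add: cl)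
qed

text \<open>
  Cauchy's estimates on the circle of radius \<open>R\<close>, evaluated at most half way out.
\<close>

lemma gap_series_majorant:
  fixes a :: "nat \<Rightarrow> complex"
  assumes l: "strict_mono l" and B: "\<And>z. (\<lambda>k. a k * z ^ l k) sums B z" and hol: "B holomorphic_on UNIV"
    and R: "R > 0" "\<And>z. norm z = R \<Longrightarrow> norm (B z) \<le> M" and x: "0 \<le> x" "2 * x \<le> R"
  shows "summable (\<lambda>k. norm (a k) * x ^ l k)" "(\<Sum>k. norm (a k) * x ^ l k) \<le> 2 * M"
proof -
  have M0: "M \<ge> 0" using order.trans[OF norm_ge_zero R(2)[of "of_real R"]] R(1) by simp
  have bound: "norm (a k) * x ^ l k \<le> M * (1 / 2) ^ k" for k
  proof -
    have "norm ((deriv ^^ l k) B 0) \<le> fact (l k) * M / R ^ l k"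
      by (rule Cauchy_inequality)
         (use R hol in \<open>auto intro: holomorphic_on_subset holomorphic_on_imp_continuous_on\<close>)
    moreover have "norm ((deriv ^^ l k) B 0) = fact (l k) * norm (a k)"
      unfolding gap_series_taylor_coefficient[OF l B, of k, symmetric] by (simp add: norm_divide)
    ultimately have "fact (l k) * norm (a k) \<le> fact (l k) * (M / R ^ l k)" by simp
    then have "norm (a k) \<le> M / R ^ l k" by (simp only: mult_le_cancel_left_pos fact_gt_zero)
    then have "norm (a k) * x ^ l k \<le> M / R ^ l k * x ^ l k" using x by (intro mult_right_mono) auto
    also have "\<dots> = M * (x / R) ^ l k" by (simp add: power_divide)
    also have "\<dots> \<le> M * (1 / 2) ^ l k"
      using x R M0 by (intro mult_left_mono power_mono) (auto simp: field_simps)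
    also have "\<dots> \<le> M * (1 / 2) ^ k"
      using M0 strict_mono_ge_id[OF l, of k] by (intro mult_left_mono power_decreasing) auto
    finally show ?thesis .
  qed
  have g: "(\<lambda>k. M * (1 / 2) ^ k) sums (M * (1 / (1 - 1 / 2)))"
    by (intro sums_mult geometric_sums) auto
  show s: "summable (\<lambda>k. norm (a k) * x ^ l k)"
    by (rule summable_comparison_test'[OF sums_summable[OF g], of 0]) (use bound x in auto)
  show "(\<Sum>k. norm (a k) * x ^ l k) \<le> 2 * M"
    using suminf_le[OF bound s sums_summable[OF g]] sums_unique[OF g] by simp
qed

text \<open>
  Otherwise \<open>g\<close> would grow at least like \<open>(2 b)^j\<close>, against the bound \<open>b^j\<close>. It is applied with \<open>g j = ln (G (4^j))\<close>.
\<close>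

lemma regular_growth_points:
  fixes g :: "nat \<Rightarrow> real"
  assumes pos: "\<And>j. j \<ge> J \<Longrightarrow> g j > 0" and le: "\<And>j. j \<ge> J \<Longrightarrow> g j \<le> b ^ j" and b: "b \<ge> 1"
  shows "\<exists>j\<ge>J. g (Suc j) \<le> 2 * b * g j"
proof (rule ccontr)
  assume neg: "\<not> ?thesis"
  have "(2 * b) ^ i * g J \<le> g (J + i)" for i
  proof (induction i)
    case (Suc i)
    have "(2 * b) ^ Suc i * g J = 2 * b * ((2 * b) ^ i * g J)" by simp
    also have "\<dots> \<le> 2 * b * g (J + i)" using Suc b by (intro mult_left_mono) auto
    also have "\<dots> \<le> g (Suc (J + i))" using neg by (metis le_add1 linear)
    also have "Suc (J + i) = J + Suc i" by simp
    finally show ?case .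
  qed simp
  then have "(2 * b) ^ i * g J \<le> b ^ (J + i)" for i
    using order.trans[OF _ le[of "J + i"]] by simp
  then have "b ^ i * (2 ^ i * g J) \<le> b ^ i * b ^ J" for i
    unfolding power_mult_distrib power_add by (metis mult.assoc mult.commute)
  then have "2 ^ i * g J \<le> b ^ J" for i
    using b by (simp add: mult_le_cancel_left)
  then have le': "2 ^ i \<le> b ^ J / g J" for i
    using pos[of J] by (simp add: field_simps)
  obtain i where "b ^ J / g J < 2 ^ i" using real_arch_pow[of 2 "b ^ J / g J"] by auto
  with le'[of i] show False by simp
qed

text \<open>
  At the chosen radius \<open>r\<close> the polynomial part of degree at most \<open>T\<close> differs from \<open>B\<close> by at most 1, so it has
  polynomial size on an arc, and this bounds its coefficients. The constant \<open>\<eta>\<close> is so small that the factor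
  \<open>exp (3 \<eta> T)\<close> lost in this step is only about \<open>sqrt (G r)\<close>.
\<close>

lemma gap_series_not_polynomial_on_arcs:
  fixes a :: "nat \<Rightarrow> complex" and l :: "nat \<Rightarrow> nat"
  assumes l: "strict_mono l" and a: "\<And>k. a k \<noteq> 0"
    and B: "\<And>z. (\<lambda>k. a k * z ^ l k) sums B z" and hol: "B holomorphic_on UNIV"
    and sum: "summable (\<lambda>k. 1 / real (l k))" and \<delta>: "\<delta> > 0"
    and order: "\<And>x. x \<ge> \<xi> \<Longrightarrow> (\<Sum>k. norm (a k) * x ^ l k) \<le> exp (x ^ q)"
    and arcs: "\<And>x. x \<ge> \<xi> \<Longrightarrow>
      \<exists>r\<in>{x..x+1}. \<forall>\<theta>\<in>{\<phi>..\<phi> + \<delta>}. norm (B (of_real r * exp (\<i> * of_real \<theta>))) \<le> x ^ L"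
  shows False
proof -
  define G where "G x = (\<Sum>k. norm (a k) * x ^ l k)" for x :: real
  have summ: "summable (\<lambda>k. norm (a k) * x ^ l k)" if "x \<ge> 0" for x
  proof -
    define R where "R = 2 * x + 1"
    have "compact (B ` sphere 0 R)"
      by (intro compact_continuous_image holomorphic_on_imp_continuous_on holomorphic_on_subset[OF hol]) auto
    then obtain M where "\<And>z. z \<in> B ` sphere 0 R \<Longrightarrow> norm z \<le> M"
      using compact_imp_bounded bounded_iff by metis
    then show ?thesis
      using that by (intro gap_series_majorant(1)[OF l B hol, of R M]) (auto simp: R_def)
  qed
  have G_mono: "G x \<le> G y" if "0 \<le> x" "x \<le> y" for x y
    unfolding G_def using that by (intro suminf_le mult_left_mono power_mono summ) auto
  have G_ge: "norm (a k) * x ^ l k \<le> G x" if "x \<ge> 0" for k x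
    unfolding G_def using sum_le_suminf[OF summ[OF that], of "{k}"] that by simp
  define b :: real where "b = 4 ^ q"
  define C where "C = 2 * b"
  have b: "b \<ge> 1" and C: "C \<ge> 2" by (simp_all add: b_def C_def)
  define \<eta> where "\<eta> = 1 / (12 * C)"
  have \<eta>: "0 < \<eta>" "\<eta> \<le> 1" using C by (simp_all add: \<eta>_def)
  obtain T0 where T0: "\<forall>T\<ge>T0. \<forall>c \<theta>0 M.
    (\<forall>\<theta>\<in>{\<theta>0..\<theta>0 + \<delta>}. norm (\<Sum>k | l k \<le> T. c k * exp (\<i> * of_real (real (l k) * \<theta>))) \<le> M) \<longrightarrow>
    (\<Sum>k | l k \<le> T. norm (c k)) \<le> exp (3 * \<eta> * real T) * M"
    using gap_polynomial_coefficient_bound[OF l sum \<eta> \<delta>] by blast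
  define W where "W = exp (real T0 / (2 * C)) + 1"
  \<comment> \<open>Large enough for \<open>ln (G x)\<close> to be positive and to force \<open>T \<ge> T0\<close>, and for the final contradiction
    with the coefficient of index \<open>2 L + 1\<close>, whose exponent is at least \<open>2 L + 1\<close>.\<close>
  define X where "X = Max {\<xi>, 1, W / norm (a 1), 50 / norm (a (2 * L + 1))}"
  obtain J where J: "X < 4 ^ J" using real_arch_pow[of 4 X] by auto
  have large: "4 ^ j \<ge> \<xi>" "4 ^ j \<ge> (1 :: real)" "4 ^ j \<ge> W / norm (a 1)"
    "4 ^ j \<ge> 50 / norm (a (2 * L + 1))" if "j \<ge> J" for j
  proof -
    have "(4 :: real) ^ J \<le> 4 ^ j" using that by (intro power_increasing) auto
    then have "X \<le> 4 ^ j" using J by linarith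
    then show "4 ^ j \<ge> \<xi>" "4 ^ j \<ge> (1 :: real)" "4 ^ j \<ge> W / norm (a 1)"
      "4 ^ j \<ge> 50 / norm (a (2 * L + 1))" by (simp_all add: X_def)
  qed
  have GW: "G (4 ^ j) \<ge> W" if "j \<ge> J" for j
  proof -
    have "W \<le> norm (a 1) * 4 ^ j"
      using large(3)[OF that] a[of 1] by (simp add: divide_le_eq mult.commute)
    also have "\<dots> \<le> norm (a 1) * (4 ^ j) ^ l 1"
      using strict_mono_ge_id[OF l, of 1] by (intro mult_left_mono self_le_power) auto
    also have "\<dots> \<le> G (4 ^ j)" by (rule G_ge) simp
    finally show ?thesis .
  qed
  have W1: "W > 1" by (simp add: W_def)
  define g where "g j = ln (G (4 ^ j))" for j
  have "\<exists>j\<ge>J. g (Suc j) \<le> 2 * b * g j"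
  proof (rule regular_growth_points[OF _ _ b])
    fix j assume j: "j \<ge> J"
    show "g j > 0" unfolding g_def using GW[OF j] W1 by (intro ln_gt_zero) simp
    have "G (4 ^ j) \<le> exp ((4 ^ j) ^ q)" using order[OF large(1)[OF j]] by (simp add: G_def)
    then have "ln (G (4 ^ j)) \<le> ln (exp ((4 ^ j) ^ q))"
      using GW[OF j] W1 by (subst ln_le_cancel_iff) auto
    then show "g j \<le> b ^ j" by (simp add: g_def b_def power_mult [symmetric] mult.commute)
  qed
  then obtain j where j: "j \<ge> J" "g (Suc j) \<le> C * g j" by (auto simp: C_def)
  define x :: real where "x = 4 ^ j"
  have x: "x \<ge> \<xi>" "x \<ge> 1" "x \<ge> 50 / norm (a (2 * L + 1))" "G x \<ge> W"
    using large[OF j(1)] GW[OF j(1)] by (simp_all add: x_def)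
  obtain r where r: "r \<in> {x..x+1}" and arc: "\<And>\<theta>. \<theta> \<in> {\<phi>..\<phi> + \<delta>} \<Longrightarrow>
      norm (B (of_real r * exp (\<i> * of_real \<theta>))) \<le> x ^ L"
    using arcs[OF x(1)] by blast
  have r0: "r \<ge> 1" "r > 0" using r x by auto
  have Gxr: "G x \<le> G r" using r x by (intro G_mono) auto
  have Gr: "G r \<ge> W" "G r > 1" using Gxr x(4) W1 by linarith+
  have G2r: "G (2 * r) \<le> exp (C * ln (G r))"
  proof -
    have "2 * r \<le> 4 * x" using r x(2) by simp
    then have "G (2 * r) \<le> G (4 ^ Suc j)" using r0 by (intro G_mono) (simp_all add: x_def)
    also have "\<dots> = exp (g (Suc j))"
      unfolding g_def using GW[of "Suc j"] j(1) W1 by (subst exp_ln) auto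
    also have "\<dots> \<le> exp (C * g j)" using j(2) by simp
    also have "g j \<le> ln (G r)"
      unfolding g_def x_def [symmetric] using Gxr x(4) W1 by (subst ln_le_cancel_iff) auto
    finally show ?thesis using C by simp
  qed
  \<comment> \<open>Halving the radius gains the factor \<open>2 powr (- T)\<close> on the terms of degree above \<open>T\<close>, which
    outweighs \<open>G (2 r) \<le> exp (C ln (G r))\<close>.\<close>
  define T where "T = nat \<lceil>2 * C * ln (G r)\<rceil>"
  have lnG: "ln (G r) > 0" using Gr by simp
  have T: "real T \<ge> 2 * C * ln (G r)" "real T \<le> 2 * C * ln (G r) + 1"
    using lnG C by (simp_all add: T_def) 
  have "real T0 / (2 * C) \<le> ln (G r)"
  proof -
    have "exp (real T0 / (2 * C)) \<le> G r" using Gr(1) by (simp add: W_def)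
    then show ?thesis using Gr(2) by (simp add: ln_ge_iff)
  qed
  then have "T0 \<le> T" using T(1) C by (simp add: field_simps)
  \<comment> \<open>The exponents increase, so those at most \<open>T\<close> have the indices below \<open>N\<close>.\<close>
  define N where "N = (LEAST N. T < l N)"
  have "T < l (Suc T)" using strict_mono_ge_id[OF l, of "Suc T"] by simp
  then have lN: "T < l N" unfolding N_def by (rule LeastI)
  have KN: "{k. l k \<le> T} = {..<N}"
  proof (intro set_eqI iffI)
    fix k assume "k \<in> {k. l k \<le> T}"
    then have "l k < l N" using lN by simp
    then show "k \<in> {..<N}" using strict_mono_less[OF l] by simp
  next
    fix k assume "k \<in> {..<N}"
    then have "\<not> T < l k" unfolding N_def using not_less_Least by blast
    then show "k \<in> {k. l k \<le> T}" by simp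
  qed
  define t where "t k = norm (a (k + N)) * r ^ l (k + N)" for k
  have t_summ: "summable t"
    unfolding t_def using summ[of r] r0 by (subst summable_iff_shift) auto
  have tail: "suminf t \<le> 1"
  proof -
    have "suminf t \<le> (\<Sum>k. (1 / 2) ^ T * (norm (a (k + N)) * (2 * r) ^ l (k + N)))"
    proof (rule suminf_le[OF _ t_summ])
      show "summable (\<lambda>k. (1 / 2) ^ T * (norm (a (k + N)) * (2 * r) ^ l (k + N)))"
        using summ[of "2 * r"] r0 by (intro summable_mult) (subst summable_iff_shift, auto)
      fix k
      have "l N \<le> l (k + N)" using l by (simp add: strict_mono_less_eq)
      then have "T \<le> l (k + N)" using lN by simp
      then have "(1 / 2) ^ l (k + N) \<le> (1 / 2 :: real) ^ T" by (intro power_decreasing) auto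
      then have "(1 / 2) ^ l (k + N) * (norm (a (k + N)) * (2 * r) ^ l (k + N)) \<le>
          (1 / 2) ^ T * (norm (a (k + N)) * (2 * r) ^ l (k + N))"
        using r0 by (intro mult_right_mono) auto
      moreover have "(1 / 2) ^ l (k + N) * (norm (a (k + N)) * (2 * r) ^ l (k + N)) = t k"
        by (simp add: t_def power_mult_distrib power_divide)
      ultimately show "t k \<le> (1 / 2) ^ T * (norm (a (k + N)) * (2 * r) ^ l (k + N))" by simp
    qed
    also have "\<dots> = (1 / 2) ^ T * (\<Sum>k. norm (a (k + N)) * (2 * r) ^ l (k + N))"
      using summ[of "2 * r"] r0 by (intro suminf_mult) (subst summable_iff_shift, auto)
    also have "(\<Sum>k. norm (a (k + N)) * (2 * r) ^ l (k + N)) \<le> G (2 * r)"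
    proof -
      have "G (2 * r) = (\<Sum>k. norm (a (k + N)) * (2 * r) ^ l (k + N)) + (\<Sum>k<N. norm (a k) * (2 * r) ^ l k)"
        unfolding G_def using summ[of "2 * r"] r0 by (intro suminf_split_initial_segment) auto
      moreover have "(\<Sum>k<N. norm (a k) * (2 * r) ^ l k) \<ge> 0" using r0 by (intro sum_nonneg) auto
      ultimately show ?thesis by simp
    qed
    also note G2r
    also have "(1 / 2) ^ T * exp (C * ln (G r)) \<le> 1"
    proof -
      have "(1 / 2 :: real) ^ T = exp (real T * (- ln 2))"
        unfolding exp_of_nat_mult by (simp add: exp_minus power_divide)
      also have "\<dots> * exp (C * ln (G r)) = exp (C * ln (G r) - real T * ln 2)"
        by (simp add: exp_add [symmetric])
      also have "C * ln (G r) \<le> real T * (1 / 2)" using T(1) by simp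
      also have "real T * (1 / 2) \<le> real T * ln 2"
        using ln2_ge_two_thirds by (intro mult_left_mono) auto
      finally show ?thesis by simp
    qed
    finally show ?thesis by simp
  qed
  have xL: "x ^ L \<ge> 1" using x by simp
  define c where "c k = a k * of_real (r ^ l k)" for k
  have normc: "norm (c k) = norm (a k) * r ^ l k" for k
    using r0 by (simp add: c_def norm_mult norm_power)
  have part: "norm (\<Sum>k | l k \<le> T. c k * exp (\<i> * of_real (real (l k) * \<theta>))) \<le> 2 * x ^ L"
    if \<theta>: "\<theta> \<in> {\<phi>..\<phi> + \<delta>}" for \<theta>
  proof -
    define z where "z = of_real r * exp (\<i> * of_real \<theta>)"
    have nz: "norm z = r" using r0 by (simp add: z_def norm_mult)
    have monomial: "c k * exp (\<i> * of_real (real (l k) * \<theta>)) = a k * z ^ l k" for k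
      by (simp add: c_def z_def power_mult_distrib exp_of_nat_mult [symmetric] mult_ac)
    have s: "(\<lambda>k. a (k + N) * z ^ l (k + N)) sums (B z - (\<Sum>k<N. a k * z ^ l k))"
      by (rule sums_split_initial_segment[OF B])
    have "norm (\<Sum>k. a (k + N) * z ^ l (k + N)) \<le> suminf t"
      by (rule norm_suminf_le[OF _ t_summ]) (simp add: t_def norm_mult norm_power nz)
    then have "norm (B z - (\<Sum>k<N. a k * z ^ l k)) \<le> 1" using tail sums_unique[OF s] by simp
    moreover have "norm (B z) \<le> x ^ L" using arc[OF \<theta>] by (simp add: z_def)
    moreover have "norm (\<Sum>k<N. a k * z ^ l k) \<le> norm (B z) + norm (B z - (\<Sum>k<N. a k * z ^ l k))"
      using norm_triangle_ineq4[of "B z" "B z - (\<Sum>k<N. a k * z ^ l k)"] by simp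
    ultimately show ?thesis unfolding KN monomial using xL by linarith
  qed
  have "(\<Sum>k<N. norm (c k)) \<le> exp (3 * \<eta> * real T) * (2 * x ^ L)"
    using T0[rule_format, OF \<open>T0 \<le> T\<close>, of \<phi> c "2 * x ^ L"] part unfolding KN by blast
  also have "exp (3 * \<eta> * real T) \<le> exp (ln (G r) / 2 + 1)"
  proof -
    have "3 * \<eta> * real T = real T / (4 * C)" by (simp add: \<eta>_def)
    also have "\<dots> \<le> (2 * C * ln (G r) + 1) / (4 * C)" using T(2) C by (intro divide_right_mono) auto
    also have "\<dots> = ln (G r) / 2 + 1 / (4 * C)" using C by (simp add: field_simps)
    also have "1 / (4 * C) \<le> 1" using C by simp
    finally show ?thesis by simp
  qed
  also have "exp (ln (G r) / 2 + 1) = sqrt (G r) * exp 1"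
    using Gr by (simp add: exp_add ln_sqrt [symmetric])
  also have "sqrt (G r) * exp 1 * (2 * x ^ L) \<le> sqrt (G r) * 3 * (2 * x ^ L)"
    using exp_le xL Gr by (intro mult_right_mono mult_left_mono) auto
  finally have 1: "(\<Sum>k<N. norm (a k) * r ^ l k) \<le> 6 * sqrt (G r) * x ^ L"
    using xL by (simp add: normc)
  have "G r = suminf t + (\<Sum>k<N. norm (a k) * r ^ l k)"
    unfolding G_def t_def using summ[of r] r0 by (intro suminf_split_initial_segment) auto
  also have "\<dots> \<le> 1 + 6 * sqrt (G r) * x ^ L" using tail 1 by simp
  also have "1 * 1 \<le> sqrt (G r) * x ^ L" using Gr xL by (intro mult_mono) auto
  then have "1 + 6 * sqrt (G r) * x ^ L \<le> sqrt (G r) * (7 * x ^ L)" by simp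
  finally have "sqrt (G r) * sqrt (G r) \<le> sqrt (G r) * (7 * x ^ L)" using Gr by simp
  moreover have "sqrt (G r) > 0" using Gr by simp
  ultimately have "sqrt (G r) \<le> 7 * x ^ L" by (simp only: mult_le_cancel_left_pos)
  then have "sqrt (G r) ^ 2 \<le> (7 * x ^ L) ^ 2" using Gr by (intro power_mono) auto
  then have "G r \<le> 49 * x ^ (2 * L)" using Gr by (simp add: power_mult_distrib power_mult [symmetric] mult.commute)
  moreover have "norm (a (2 * L + 1)) * x ^ (2 * L + 1) \<le> G r"
  proof -
    have "x ^ (2 * L + 1) \<le> x ^ l (2 * L + 1)"
      using x strict_mono_ge_id[OF l] by (intro power_increasing) auto
    then have "norm (a (2 * L + 1)) * x ^ (2 * L + 1) \<le> norm (a (2 * L + 1)) * x ^ l (2 * L + 1)"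
      by (intro mult_left_mono) auto
    also have "\<dots> \<le> G x" using x by (intro G_ge) auto
    finally show ?thesis using Gxr by linarith
  qed
  ultimately have "norm (a (2 * L + 1)) * x * x ^ (2 * L) \<le> 49 * x ^ (2 * L)" by (simp add: mult_ac)
  moreover have "x ^ (2 * L) > 0" using x by simp
  ultimately have "norm (a (2 * L + 1)) * x \<le> 49" by (simp only: mult_le_cancel_right_pos)
  moreover have "norm (a (2 * L + 1)) * x \<ge> 50"
    using x(3) a[of "2 * L + 1"] by (simp add: divide_le_eq mult.commute)
  ultimately show False by simp
qed

section \<open>The differential equation\<close>

theorem corollary1:
  fixes A B f :: "complex \<Rightarrow> complex" and n :: nat
  assumes "A holomorphic_on UNIV"
    and "n > 0"
    and "zero_exponent A < growth_order A"
    and "growth_order A = ereal (real n)"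
    and "B holomorphic_on UNIV"
    and "fejer_gaps B"
    and "f holomorphic_on UNIV"
    and "\<And>z. deriv (deriv f) z + A z * deriv f z + B z * f z = 0"
    and "\<exists>z. f z \<noteq> 0"
  shows "growth_order f = \<infinity>"
proof (rule ccontr)
  assume "growth_order f \<noteq> \<infinity>"
  then obtain K rf where "\<And>r. r \<ge> rf \<Longrightarrow> nevanlinna_T f r \<le> r ^ K"
    using growth_order_finite_imp_power_bound by blast
  then obtain L x0 where x0: "x0 \<ge> 1" and good: "\<forall>x\<ge>x0. \<exists>r\<in>{x..x+1}. \<forall>z. norm z = r \<longrightarrow>
    f z \<noteq> 0 \<and> norm (deriv f z / f z) \<le> x ^ L \<and> norm (deriv (deriv f) z / f z) \<le> x ^ L"
    using log_derivatives_polynomial_on_circles[OF assms(7,9), of rf K] by blast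
  obtain \<theta>0 xA where xA: "xA \<ge> 1" and
    sector: "\<And>r \<theta>. r \<ge> xA \<Longrightarrow> \<theta> \<in> {\<theta>0..\<theta>0 + 1 / real n} \<Longrightarrow> norm (A (of_real r * exp (\<i> * of_real \<theta>))) \<le> 1"
    and A_le: "\<And>z. norm z \<ge> xA \<Longrightarrow> norm (A z) \<le> exp (norm z ^ (n + 1))"
    using small_sector[OF assms(1-4)] by blast
  obtain l a where l: "strict_mono (l :: nat \<Rightarrow> nat)" and a: "\<And>k. a k \<noteq> 0"
    and B: "\<And>z. (\<lambda>k. a k * z ^ l k) sums B z" and sum: "summable (\<lambda>k. 1 / real (l k))"
    using assms(6) unfolding fejer_gaps_def by blast
  have B_le: "norm (B z) \<le> x ^ L * (1 + norm (A z))"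
    if "f z \<noteq> 0" "norm (deriv f z / f z) \<le> x ^ L" "norm (deriv (deriv f) z / f z) \<le> x ^ L" for x z
  proof -
    have "B z * f z = - (deriv (deriv f) z + A z * deriv f z)"
      using assms(8)[of z] unfolding add_eq_0_iff .
    then have "B z = - (deriv (deriv f) z / f z + A z * (deriv f z / f z))"
      using that(1) by (simp add: field_simps)
    then have "norm (B z) = norm (deriv (deriv f) z / f z + A z * (deriv f z / f z))"
      by (simp only: norm_minus_cancel)
    also have "\<dots> \<le> norm (deriv (deriv f) z / f z) + norm (A z) * norm (deriv f z / f z)"
      unfolding norm_mult [symmetric] by (rule norm_triangle_ineq)
    also have "\<dots> \<le> x ^ L + norm (A z) * x ^ L"
      using that by (intro add_mono mult_left_mono) auto
    finally show ?thesis by (simp add: algebra_simps)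
  qed
  \<comment> \<open>At \<open>y \<ge> c\<close> the crude bound \<open>exp (2 + 2 L y + (3 y)^(n + 1))\<close> for the majorant of \<open>B\<close> is at most
    \<open>exp (y^(n + 2))\<close>.\<close>
  define c where "c = 2 + 2 * real L + 3 ^ (n + 1)"
  define X where "X = max (max x0 xA) (max 2 c)"
  show False
  proof (rule gap_series_not_polynomial_on_arcs[OF l a B assms(5) sum, where
      \<xi> = X and q = "n + 2" and \<delta> = "1 / real n" and \<phi> = \<theta>0 and L = "L + 1"])
    show "1 / real n > 0" using assms(2) by simp
  next
    fix x assume "x \<ge> X"
    then have x: "x \<ge> x0" "x \<ge> xA" "x \<ge> 2" by (auto simp: X_def)
    obtain r where r: "r \<in> {x..x+1}" and rz: "\<And>z. norm z = r \<Longrightarrow>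
        f z \<noteq> 0 \<and> norm (deriv f z / f z) \<le> x ^ L \<and> norm (deriv (deriv f) z / f z) \<le> x ^ L"
      using good x(1) by blast
    have "norm (B (of_real r * exp (\<i> * of_real \<theta>))) \<le> x ^ (L + 1)"
      if \<theta>: "\<theta> \<in> {\<theta>0..\<theta>0 + 1 / real n}" for \<theta>
    proof -
      define z where "z = of_real r * exp (\<i> * of_real \<theta>)"
      have nz: "norm z = r" using r x by (simp add: z_def norm_mult)
      have "norm (B z) \<le> x ^ L * (1 + norm (A z))" using B_le rz[OF nz] by blast
      also have "\<dots> \<le> x ^ L * x"
        using sector[of r \<theta>] \<theta> r x by (intro mult_left_mono) (auto simp: z_def)
      finally show ?thesis by (simp add: z_def mult.commute)
    qed
    with r show "\<exists>r\<in>{x..x+1}. \<forall>\<theta>\<in>{\<theta>0..\<theta>0 + 1 / real n}.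
        norm (B (of_real r * exp (\<i> * of_real \<theta>))) \<le> x ^ (L + 1)" by blast
  next
    fix y assume "y \<ge> X"
    then have y: "y \<ge> x0" "y \<ge> xA" "y \<ge> 2" "y \<ge> c" by (auto simp: X_def)
    \<comment> \<open>The majorant at \<open>y\<close> is controlled by \<open>B\<close> on a circle of at least twice the radius.\<close>
    define x where "x = 2 * y"
    have x: "x \<ge> x0" using y by (simp add: x_def)
    obtain r where r: "r \<in> {x..x+1}" and rz: "\<And>z. norm z = r \<Longrightarrow>
        f z \<noteq> 0 \<and> norm (deriv f z / f z) \<le> x ^ L \<and> norm (deriv (deriv f) z / f z) \<le> x ^ L"
      using good x by blast
    define E where "E = (3 * y) ^ (n + 1)"
    have E: "E \<ge> 0" using y by (simp add: E_def)
    have Bz: "norm (B z) \<le> exp (real L * (2 * y) + (1 + E))" if z: "norm z = r" for z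
    proof -
      have "norm (A z) \<le> exp (r ^ (n + 1))" using A_le[of z] z r y by (simp add: x_def)
      also have "r ^ (n + 1) \<le> E" unfolding E_def using r y by (intro power_mono) (auto simp: x_def)
      finally have "norm (A z) \<le> exp E" by simp
      then have "1 + norm (A z) \<le> 2 * exp E" using E one_le_exp_iff[of E] by linarith
      also have "\<dots> \<le> exp 1 * exp E" using exp_ge_add_one_self[of 1] by (intro mult_right_mono) auto
      finally have 1: "1 + norm (A z) \<le> exp (1 + E)" by (simp add: exp_add)
      have "x \<le> exp x" using exp_ge_add_one_self[of x] by linarith
      then have "x ^ L \<le> exp x ^ L" using y by (intro power_mono) (auto simp: x_def)
      then have 2: "x ^ L \<le> exp (real L * (2 * y))" by (simp add: x_def exp_of_nat_mult)
      have "norm (B z) \<le> x ^ L * (1 + norm (A z))" using B_le rz[OF z] by blast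
      also have "\<dots> \<le> exp (real L * (2 * y)) * exp (1 + E)"
        using 1 2 by (intro mult_mono) auto
      finally show ?thesis by (simp add: exp_add)
    qed
    have "(\<Sum>k. norm (a k) * y ^ l k) \<le> 2 * exp (real L * (2 * y) + (1 + E))"
      by (rule gap_series_majorant(2)[OF l B assms(5) _ Bz]) (use r y in \<open>auto simp: x_def\<close>)
    also have "\<dots> \<le> exp 1 * exp (real L * (2 * y) + (1 + E))"
      using exp_ge_add_one_self[of 1] by (intro mult_right_mono) auto
    also have "\<dots> = exp (2 + 2 * real L * y + E)" by (simp add: exp_add [symmetric] algebra_simps)
    also have "2 + 2 * real L * y + E \<le> y ^ (n + 2)"
    proof -
      have p: "y \<le> y ^ (n + 1)" "1 \<le> y ^ (n + 1)"
        using y(3) by (intro self_le_power one_le_power; simp)+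
      have "2 + 2 * real L * y + E \<le> 2 * y ^ (n + 1) + 2 * real L * y ^ (n + 1) + 3 ^ (n + 1) * y ^ (n + 1)"
        unfolding E_def power_mult_distrib using p by (intro add_mono mult_left_mono) auto
      also have "\<dots> = c * y ^ (n + 1)" by (simp add: c_def algebra_simps)
      also have "\<dots> \<le> y * y ^ (n + 1)" using y p by (intro mult_right_mono) auto
      finally show ?thesis by simp
    qed
    finally show "(\<Sum>k. norm (a k) * y ^ l k) \<le> exp (y ^ (n + 2))" by simp
  qed
qed

end
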